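(* There exists a unique $\mathbb{Q}(q)$-algebra anti-homomorphism $\Xi:\mathfrak{HH}_m\to\mathrm{End}_{\mathbb{Q}(q)}(\underline{V}^{\otimes m})$ from the duplex Hecke algebra $\mathfrak{HH}_m$ of type $\mathsf{B}$ such that \begin{align*} &\Xi(T_i)=\Psi(H_i) &&\text{for } i=0,1,\dots,m-1;\\ &\Xi(x_\sigma^{(l)})|_{\underline{V}_{\underline{l},\emptyset}^{\otimes m}}=\Psi_l^V(H_\sigma)\otimes\mathrm{id}^{\otimes m-l} &&\text{for } \sigma\in\mathfrak{S}_l,\ 0\le l\le m;\\ &\Xi(x_\sigma^{(l)})(M_f)=0 &&\text{for } \sigma\in\mathfrak{S}_l,\ 0\le l\le m,\ \text{and } M_f\notin\underline{V}_{\underline{l},\emptyset}^{\otimes m}. \end{align*}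
   Context: Fix integers $r\ge 1$ and $m\ge 2$; $q$ is transcendental over $\mathbb{Q}$ and the base field is $\mathbb{Q}(q)$. Put $\mathbb{I}_{2r+2}=\{-r-\tfrac12,-r+\tfrac12,\dots,r+\tfrac12\}$ and $\mathbb{I}_{2r+4}=\{-r-\tfrac32,-r-\tfrac12,\dots,r+\tfrac32\}$. $\underline{V}$ is the $\mathbb{Q}(q)$-space with basis $\{\eta_j: j\in\mathbb{I}_{2r+4}\}$, and $V\subset\underline{V}$ is the span of $\{\eta_j: j\in\mathbb{I}_{2r+2}\}$. For $f=(f(1),\dots,f(m))\in\mathbb{I}_{2r+4}^m$ put $M_f=\eta_{f(1)}\otimes\cdots\otimes\eta_{f(m)}$; these form a basis of $\underline{V}^{\otimes m}$. For $0\le l\le m$ let $\underline{V}_{\underline{l},\emptyset}^{\otimes m}=V^{\otimes l}\otimes\eta_{r+3/2}^{\otimes m-l}$. Hecke algebra and its right action. $\mathcal{H}(\mathsf{B}_l)$ is the $\mathbb{Q}(q)$-algebra generated by $H_0,\dots,H_{l-1}$ with relations $(H_i-q^{-1})(H_i+q)=0$; $H_iH_{i+1}H_i=H_{i+1}H_iH_{i+1}$ for $1\le i\le l-2$; $H_iH_j=H_jH_i$ for $|i-j|>1$; $H_0H_1H_0H_1=H_1H_0H_1H_0$ (with $\mathcal{H}(\mathsf{B}_0)=\mathbb{Q}(q)$). For $\sigma\in\mathfrak{S}_l=\langle s_1,\dots,s_{l-1}\rangle$ with reduced expression $s_{i_1}\cdots s_{i_k}$, $H_\sigma=H_{i_1}\cdots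 H_{i_k}$. For $f\in\mathbb{I}_{2r+4}^m$, $fs_i$ ($i\ge1$) is $f$ with entries $i,i+1$ swapped, and $fs_0=(-f(1),f(2),\dots,f(m))$. $\mathcal{H}(\mathsf{B}_m)$ acts on $\underline{V}^{\otimes m}$ on the right (action $\Psi$) by: for $i\ge1$, $M_fH_i=q^{-1}M_f$ if $f(i)=f(i+1)$, $M_fH_i=M_{fs_i}$ if $f(i)<f(i+1)$, $M_fH_i=M_{fs_i}+(q^{-1}-q)M_f$ if $f(i)>f(i+1)$; $M_fH_0=M_{fs_0}$ if $f(1)>0$, and $M_fH_0=M_{fs_0}+(q^{-1}-q)M_f$ if $f(1)<0$. By the same formulas $\mathcal{H}(\mathsf{B}_l)$ acts on the right on $V^{\otimes l}$; this action is denoted $\Psi_l^V$. We write $\Psi(h)$, $\Psi_l^V(h)$ for the corresponding operators (so $\Psi,\Psi^V_l$ are anti-homomorphisms). Duplex Hecke algebra. $\mathfrak{HH}_m$ is the $\mathbb{Q}(q)$-algebra generated by $T_0,\dots,T_{m-1}$ and $x_\sigma^{(l)}$ ($0\le l\le m$, $\sigma\in\mathfrak{S}_l$, with $\mathfrak{S}_0=\mathfrak{S}_1$ trivial) with relations: the $T_i$ satisfy the relations of the generators $H_i$ of $\mathcal{H}(\mathsf{B}_m)$; for $0<i<l$, with $\ell$ the length function, $x_\sigma^{(l)}x_{s_i}^{(l)}=x_{\sigma s_i}^{(l)}$ if $\ell(\sigma s_i)=\ell(\sigma)+1$ and $=x_{\sigma s_i}^{(l)}+(q^{-1}-q)x_\sigma^{(l)}$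 if $\ell(\sigma s_i)=\ell(\sigma)-1$; $x_{s_i}^{(l)}x_\sigma^{(l)}=x_{s_i\sigma}^{(l)}$ if $\ell(s_i\sigma)=\ell(\sigma)+1$ and $=x_{s_i\sigma}^{(l)}+(q^{-1}-q)x_\sigma^{(l)}$ if $\ell(s_i\sigma)=\ell(\sigma)-1$; $x_\sigma^{(l)}x_\gamma^{(k)}=0$ for $l\ne k$; $T_ix_\sigma^{(l)}=x_{s_i}^{(l)}x_\sigma^{(l)}$ and $x_\sigma^{(l)}T_i=x_\sigma^{(l)}x_{s_i}^{(l)}$ for $0<i<l$; $T_ix_\sigma^{(l)}=q^{-1}x_\sigma^{(l)}=x_\sigma^{(l)}T_i$ for $i>l$. *)

theory Defs
  imports
    Complex_Main
    "HOL-Computational_Algebra.Polynomial"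
    "HOL-Computational_Algebra.Fraction_Field"
    "HOL-Library.Poly_Mapping"
    "HOL-Combinatorics.Permutations"
    "HOL-Algebra.QuotRing"
    "HOL-Algebra.Module"
begin

section \<open>The base field\<close>

text \<open>The field \<open>\<rat>(q)\<close> with \<open>q\<close> transcendental over \<open>\<rat>\<close> is, up to isomorphism, the field of
  fractions of \<open>\<rat>[q]\<close>.\<close>

type_synonym K = "rat poly fract"

definition qq :: K where
  "qq = Fraction_Field.Fract [:0, 1:] 1"


section \<open>Free algebras\<close>

text \<open>The free monoid on \<open>'g\<close>, written additively. By the multiplication of
  \<^theory>\<open>HOL-Library.Poly_Mapping\<close>, the type \<open>'g word \<Rightarrow>\<^sub>0 K\<close> is then the free associative unital
  algebra on \<open>'g\<close>, the product of two words being their concatenation.\<close>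

datatype 'g word = Word (letters: "'g list")

instantiation word :: (type) monoid_add
begin

definition zero_word :: "'a word" where
  "0 = Word []"

definition plus_word :: "'a word \<Rightarrow> 'a word \<Rightarrow> 'a word" where
  "u + v = Word (letters u @ letters v)"

instance
  by standard (simp_all add: zero_word_def plus_word_def)

end

definition monom_word :: "'g list \<Rightarrow> ('g word \<Rightarrow>\<^sub>0 K)" where
  "monom_word w = Poly_Mapping.single (Word w) 1"

abbreviation var :: "'g \<Rightarrow> ('g word \<Rightarrow>\<^sub>0 K)" where
  "var g \<equiv> monom_word [g]"

definition scale :: "K \<Rightarrow> ('a \<Rightarrow>\<^sub>0 K) \<Rightarrow> ('a \<Rightarrow>\<^sub>0 K)"  (infixr \<open>\<cdot>\<close> 75) where
  "c \<cdot> p = Poly_Mapping.map ((*) c) p"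

definition free_algebra :: "'g set \<Rightarrow> (K, 'g word \<Rightarrow>\<^sub>0 K) module" where
  "free_algebra S = ring.extend
     \<lparr>carrier = {p. \<forall>w\<in>Poly_Mapping.keys p. set (letters w) \<subseteq> S},
      mult = (*), one = 1, zero = 0, add = (+)\<rparr>
     (module.fields scale)"


section \<open>Algebras given by generators and relations\<close>

text \<open>The algebra generated by \<open>S\<close> subject to \<open>p = 0\<close> for \<open>p \<in> R\<close>. Its elements are cosets; a scalar
  \<open>c\<close> sends the coset of \<open>p\<close> to the coset of \<open>c \<cdot> p\<close>.\<close>

definition rel_ideal :: "'g set \<Rightarrow> ('g word \<Rightarrow>\<^sub>0 K) set \<Rightarrow> ('g word \<Rightarrow>\<^sub>0 K) set" where
  "rel_ideal S R = Idl\<^bsub>free_algebra S\<^esub> R"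

definition presented_algebra ::
    "'g set \<Rightarrow> ('g word \<Rightarrow>\<^sub>0 K) set \<Rightarrow> (K, ('g word \<Rightarrow>\<^sub>0 K) set) module" where
  "presented_algebra S R = ring.extend
     (free_algebra S Quot rel_ideal S R)
     (module.fields (\<lambda>c C. \<Union>p\<in>C. rel_ideal S R +>\<^bsub>free_algebra S\<^esub> (c \<cdot> p)))"

definition presented_gen ::
    "'g set \<Rightarrow> ('g word \<Rightarrow>\<^sub>0 K) set \<Rightarrow> 'g \<Rightarrow> ('g word \<Rightarrow>\<^sub>0 K) set" where
  "presented_gen S R g = rel_ideal S R +>\<^bsub>free_algebra S\<^esub> var g"


section \<open>Algebra anti-homomorphisms and endomorphism algebras\<close>

text \<open>Maps are taken extensional (\<^const>\<open>undefined\<close> outside the carrier), so that equality of maps is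
  equality on the carrier.\<close>

definition alg_antihom :: "(K, 'a) module \<Rightarrow> (K, 'b) module \<Rightarrow> ('a \<Rightarrow> 'b) set" where
  "alg_antihom A B = {h \<in> carrier A \<rightarrow>\<^sub>E carrier B.
     h \<one>\<^bsub>A\<^esub> = \<one>\<^bsub>B\<^esub> \<and>
     (\<forall>x\<in>carrier A. \<forall>y\<in>carrier A. h (x \<oplus>\<^bsub>A\<^esub> y) = h x \<oplus>\<^bsub>B\<^esub> h y) \<and>
     (\<forall>x\<in>carrier A. \<forall>y\<in>carrier A. h (x \<otimes>\<^bsub>A\<^esub> y) = h y \<otimes>\<^bsub>B\<^esub> h x) \<and>
     (\<forall>c. \<forall>x\<in>carrier A. h (c \<odot>\<^bsub>A\<^esub> x) = c \<odot>\<^bsub>B\<^esub> h x)}"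

definition End_algebra :: "('a \<Rightarrow>\<^sub>0 K) set \<Rightarrow> (K, ('a \<Rightarrow>\<^sub>0 K) \<Rightarrow> ('a \<Rightarrow>\<^sub>0 K)) module" where
  "End_algebra W = ring.extend
     \<lparr>carrier = {\<phi> \<in> W \<rightarrow>\<^sub>E W.
        (\<forall>u\<in>W. \<forall>v\<in>W. \<phi> (u + v) = \<phi> u + \<phi> v) \<and> (\<forall>c. \<forall>v\<in>W. \<phi> (c \<cdot> v) = c \<cdot> \<phi> v)},
      mult = (\<lambda>\<phi> \<psi>. \<lambda>v\<in>W. \<phi> (\<psi> v)), one = (\<lambda>v\<in>W. v),
      zero = (\<lambda>v\<in>W. 0), add = (\<lambda>\<phi> \<psi>. \<lambda>v\<in>W. \<phi> v + \<psi> v)\<rparr>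
     (module.fields (\<lambda>c \<phi>. \<lambda>v\<in>W. c \<cdot> \<phi> v))"


section \<open>The symmetric group\<close>

text \<open>\<open>\<SS>\<^sub>l\<close> is the group of all \<open>\<sigma>\<close> with \<open>\<sigma> permutes {1..l}\<close>; products are compositions of maps.\<close>

definition simple_refl :: "nat \<Rightarrow> (nat \<Rightarrow> nat)" where
  "simple_refl i = transpose i (Suc i)"

definition expression :: "nat \<Rightarrow> (nat \<Rightarrow> nat) \<Rightarrow> nat list \<Rightarrow> bool" where
  "expression l \<sigma> w \<longleftrightarrow> set w \<subseteq> {1..<l} \<and> foldr (\<lambda>i \<tau>. simple_refl i \<circ> \<tau>) w id = \<sigma>"

definition len :: "nat \<Rightarrow> (nat \<Rightarrow> nat) \<Rightarrow> nat" where
  "len l \<sigma> = (LEAST k. \<exists>w. expression l \<sigma> w \<and> length w = k)"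

definition reduced_expression :: "nat \<Rightarrow> (nat \<Rightarrow> nat) \<Rightarrow> nat list \<Rightarrow> bool" where
  "reduced_expression l \<sigma> w \<longleftrightarrow> expression l \<sigma> w \<and> length w = len l \<sigma>"


section \<open>The Hecke algebra of type B\<close>

text \<open>The relators (left-hand side minus right-hand side) for elements \<open>h 0, \<dots>, h (n - 1)\<close>.\<close>

definition hecke_relators :: "nat \<Rightarrow> (nat \<Rightarrow> ('g word \<Rightarrow>\<^sub>0 K)) \<Rightarrow> ('g word \<Rightarrow>\<^sub>0 K) set" where
  "hecke_relators n h =
     {(h i - inverse qq \<cdot> 1) * (h i + qq \<cdot> 1) | i. i < n} \<union>
     {h i * h (i + 1) * h i - h (i + 1) * h i * h (i + 1) | i. 1 \<le> i \<and> i + 1 < n} \<union>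
     {h i * h j - h j * h i | i j. i < n \<and> j < n \<and> (i + 1 < j \<or> j + 1 < i)} \<union>
     {h 0 * h 1 * h 0 * h 1 - h 1 * h 0 * h 1 * h 0 | i :: nat. 1 < n}"

definition hecke :: "nat \<Rightarrow> (K, (nat word \<Rightarrow>\<^sub>0 K) set) module" where
  "hecke n = presented_algebra {..<n} (hecke_relators n var)"

definition H_gen :: "nat \<Rightarrow> nat \<Rightarrow> (nat word \<Rightarrow>\<^sub>0 K) set" where
  "H_gen n i = presented_gen {..<n} (hecke_relators n var) i"

text \<open>\<open>H\<^sub>\<sigma>\<close> is the product of the generators along a reduced expression; by Matsumoto's theorem it does
  not depend on which one is chosen.\<close>

definition H_perm :: "nat \<Rightarrow> (nat \<Rightarrow> nat) \<Rightarrow> (nat word \<Rightarrow>\<^sub>0 K) set" where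
  "H_perm n \<sigma> = foldr (\<lambda>i a. H_gen n i \<otimes>\<^bsub>hecke n\<^esub> a) (SOME w. reduced_expression n \<sigma> w) \<one>\<^bsub>hecke n\<^esub>"


section \<open>Tensor space and the action of the Hecke algebra\<close>

text \<open>\<open>II n = {-(n-1)/2, -(n-1)/2 + 1, \<dots>, (n-1)/2}\<close>, a set of half-integers when \<open>n\<close> is even.\<close>

definition II :: "nat \<Rightarrow> rat set" where
  "II n = (\<lambda>i. of_nat i - (of_nat n - 1) / 2) ` {..<n}"

text \<open>The tensor algebra of the space with basis \<open>\<eta>\<^sub>j\<close> (\<open>j\<close> rational) is the free algebra
  \<^typ>\<open>rat word \<Rightarrow>\<^sub>0 K\<close>, with \<open>\<eta>\<^sub>j = var j\<close>, \<open>M\<^sub>f = monom_word f\<close> and \<open>\<otimes>\<close> the multiplication. The \<open>m\<close>-th tensor power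
  of the span of \<open>{\<eta>\<^sub>j | j \<in> J}\<close> is the span of the \<open>M\<^sub>f\<close> with \<open>f \<in> J\<^sup>m\<close>. Tuples \<open>f\<close> are lists, so the
  entry \<open>f(i)\<close> is \<open>f ! (i - 1)\<close>.\<close>

definition tuples :: "rat set \<Rightarrow> nat \<Rightarrow> rat list set" where
  "tuples J m = {f. set f \<subseteq> J \<and> length f = m}"

definition tensor_power :: "rat set \<Rightarrow> nat \<Rightarrow> (rat word \<Rightarrow>\<^sub>0 K) set" where
  "tensor_power J m = {v. \<forall>w\<in>Poly_Mapping.keys v. letters w \<in> tuples J m}"

definition tuple_s :: "nat \<Rightarrow> rat list \<Rightarrow> rat list" where
  "tuple_s i f =
     (if i = 0 then f[0 := - (f ! 0)] else f[i - 1 := f ! i, i := f ! (i - 1)])"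

text \<open>\<open>M\<^sub>f H\<^sub>i\<close>\<close>

definition basis_act :: "nat \<Rightarrow> rat list \<Rightarrow> (rat word \<Rightarrow>\<^sub>0 K)" where
  "basis_act i f =
     (if i = 0 then
        (if f ! 0 > 0 then monom_word (tuple_s 0 f)
         else monom_word (tuple_s 0 f) + (inverse qq - qq) \<cdot> monom_word f)
      else if f ! (i - 1) = f ! i then inverse qq \<cdot> monom_word f
      else if f ! (i - 1) < f ! i then monom_word (tuple_s i f)
      else monom_word (tuple_s i f) + (inverse qq - qq) \<cdot> monom_word f)"

definition gen_act ::
    "rat set \<Rightarrow> nat \<Rightarrow> nat \<Rightarrow> (rat word \<Rightarrow>\<^sub>0 K) \<Rightarrow> (rat word \<Rightarrow>\<^sub>0 K)" where
  "gen_act J m i = (\<lambda>v\<in>tensor_power J m.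
     \<Sum>w\<in>Poly_Mapping.keys v. Poly_Mapping.lookup v w \<cdot> basis_act i (letters w))"

text \<open>The right action of \<^term>\<open>hecke m\<close> on \<^term>\<open>tensor_power J m\<close>, for \<open>J\<close> closed under negation and
  not containing \<open>0\<close>. Right multiplications compose in the opposite order, hence an
  anti-homomorphism.\<close>

definition Psi ::
    "rat set \<Rightarrow> nat \<Rightarrow> (nat word \<Rightarrow>\<^sub>0 K) set \<Rightarrow> (rat word \<Rightarrow>\<^sub>0 K) \<Rightarrow> (rat word \<Rightarrow>\<^sub>0 K)" where
  "Psi J m = (THE \<psi>. \<psi> \<in> alg_antihom (hecke m) (End_algebra (tensor_power J m)) \<and>
                     (\<forall>i<m. \<psi> (H_gen m i) = gen_act J m i))"

text \<open>With \<open>J = II (2 * r + 2)\<close>, the \<open>l\<close>-th tensor power of \<open>V\<close> times the one-dimensional space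
  spanned by the \<open>(m - l)\<close>-th tensor power of \<open>\<eta>\<close> with index \<open>r + 3/2\<close>; every element is a pure tensor.\<close>

definition eta_top :: "nat \<Rightarrow> (rat word \<Rightarrow>\<^sub>0 K)" where
  "eta_top r = var (of_nat r + 3 / 2)"

definition V_sub :: "nat \<Rightarrow> nat \<Rightarrow> nat \<Rightarrow> (rat word \<Rightarrow>\<^sub>0 K) set" where
  "V_sub r m l = {v * eta_top r ^ (m - l) | v. v \<in> tensor_power (II (2 * r + 2)) l}"


section \<open>The duplex Hecke algebra of type B\<close>

datatype duplex_gen = T_gen nat | x_gen nat "nat \<Rightarrow> nat"

definition duplex_gens :: "nat \<Rightarrow> duplex_gen set" where
  "duplex_gens m = {T_gen i | i. i < m} \<union> {x_gen l \<sigma> | l \<sigma>. l \<le> m \<and> \<sigma> permutes {1..l}}"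

definition duplex_relators :: "nat \<Rightarrow> (duplex_gen word \<Rightarrow>\<^sub>0 K) set" where
  "duplex_relators m =
    (let T = (\<lambda>i. var (T_gen i)); x = (\<lambda>l \<sigma>. var (x_gen l \<sigma>)) in
     hecke_relators m T \<union>
     {x l \<sigma> * x l (simple_refl i) - x l (\<sigma> \<circ> simple_refl i) | l \<sigma> i.
        l \<le> m \<and> \<sigma> permutes {1..l} \<and> 0 < i \<and> i < l \<and> len l (\<sigma> \<circ> simple_refl i) = len l \<sigma> + 1} \<union>
     {x l \<sigma> * x l (simple_refl i) - (x l (\<sigma> \<circ> simple_refl i) + (inverse qq - qq) \<cdot> x l \<sigma>) | l \<sigma> i.
        l \<le> m \<and> \<sigma> permutes {1..l} \<and> 0 < i \<and> i < l \<and> len l (\<sigma> \<circ> simple_refl i) + 1 = len l \<sigma>} \<union>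
     {x l (simple_refl i) * x l \<sigma> - x l (simple_refl i \<circ> \<sigma>) | l \<sigma> i.
        l \<le> m \<and> \<sigma> permutes {1..l} \<and> 0 < i \<and> i < l \<and> len l (simple_refl i \<circ> \<sigma>) = len l \<sigma> + 1} \<union>
     {x l (simple_refl i) * x l \<sigma> - (x l (simple_refl i \<circ> \<sigma>) + (inverse qq - qq) \<cdot> x l \<sigma>) | l \<sigma> i.
        l \<le> m \<and> \<sigma> permutes {1..l} \<and> 0 < i \<and> i < l \<and> len l (simple_refl i \<circ> \<sigma>) + 1 = len l \<sigma>} \<union>
     {x l \<sigma> * x k \<gamma> | l \<sigma> k \<gamma>.
        l \<le> m \<and> k \<le> m \<and> l \<noteq> k \<and> \<sigma> permutes {1..l} \<and> \<gamma> permutes {1..k}} \<union>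
     {T i * x l \<sigma> - x l (simple_refl i) * x l \<sigma> | l \<sigma> i.
        l \<le> m \<and> \<sigma> permutes {1..l} \<and> 0 < i \<and> i < l} \<union>
     {x l \<sigma> * T i - x l \<sigma> * x l (simple_refl i) | l \<sigma> i.
        l \<le> m \<and> \<sigma> permutes {1..l} \<and> 0 < i \<and> i < l} \<union>
     {T i * x l \<sigma> - inverse qq \<cdot> x l \<sigma> | l \<sigma> i.
        l \<le> m \<and> \<sigma> permutes {1..l} \<and> l < i \<and> i < m} \<union>
     {x l \<sigma> * T i - inverse qq \<cdot> x l \<sigma> | l \<sigma> i.
        l \<le> m \<and> \<sigma> permutes {1..l} \<and> l < i \<and> i < m})"

definition duplex :: "nat \<Rightarrow> (K, (duplex_gen word \<Rightarrow>\<^sub>0 K) set) module" where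
  "duplex m = presented_algebra (duplex_gens m) (duplex_relators m)"

definition T_elem :: "nat \<Rightarrow> nat \<Rightarrow> (duplex_gen word \<Rightarrow>\<^sub>0 K) set" where
  "T_elem m i = presented_gen (duplex_gens m) (duplex_relators m) (T_gen i)"

definition x_elem :: "nat \<Rightarrow> nat \<Rightarrow> (nat \<Rightarrow> nat) \<Rightarrow> (duplex_gen word \<Rightarrow>\<^sub>0 K) set" where
  "x_elem m l \<sigma> = presented_gen (duplex_gens m) (duplex_relators m) (x_gen l \<sigma>)"

end

theory Submission
  imports Defs
begin

text \<open>A generators-and-relations algebra has the evident universal property, so everything reduces to
  checking relations between operators on tensor space, and those can be checked on the basis \<open>M\<^sub>f\<close>. The
  operator attached to \<open>x\<^sub>\<sigma>\<^sup>(\<^sup>l\<^sup>)\<close> is forced: on tensors \<open>v \<otimes> \<eta> \<otimes> \<dots> \<otimes> \<eta>\<close> with \<open>v\<close> in the \<open>l\<close>-th power of the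
  span of the smaller index set it is the action of \<open>H\<^sub>\<sigma>\<close> on \<open>v\<close>, and it kills the remaining \<open>M\<^sub>f\<close>. Its
  relations hold because the generators \<open>H\<^sub>i\<close> with \<open>0 < i\<close>, \<open>i \<noteq> l\<close> preserve this splitting of the
  basis. Multiplying \<open>H\<^sub>\<sigma>\<close> by a generator requires that the action of \<open>H\<^sub>\<sigma>\<close> does not depend on the reduced
  expression, which is Matsumoto's theorem for the symmetric group.\<close>

section \<open>Free algebras and presented algebras\<close>

text \<open>The Hecke action is given by \<open>Psi\<close>, a definite description, and
  \<open>H_perm\<close>, a choice of reduced expression. Neither can be computed with until
  existence, uniqueness and independence of choices are known, so the universal property serves two
  purposes: it makes \<open>Psi\<close> available, on the larger index set at length
  \<open>m\<close> and on the smaller one at every length \<open>l\<close>, and it then yields the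
  map on \<open>duplex\<close>. The index r + 3/2 lies outside the smaller set, so the border
  between the two blocks of a tensor can be read off its entries. Hence the basis tensors kept for
  different \<open>l\<close> are disjoint, which gives the zero products, and equal entries behind
  the border give the scalar \<open>inverse qq\<close>. The reflection with index \<open>l\<close>
  exchanges entries across the border, and no relation couples \<open>T_gen l\<close> with the
  elements of level \<open>l\<close>.\<close>

lemma lookup_scale [simp]: "Poly_Mapping.lookup (c \<cdot> p) w = c * Poly_Mapping.lookup p w"
  by (simp add: scale_def Poly_Mapping.map.rep_eq when_def)

lemma scale_simps [simp]:
  "c \<cdot> (p + p') = c \<cdot> p + c \<cdot> p'" "c \<cdot> (p - p') = c \<cdot> p - c \<cdot> p'" "c \<cdot> (- p) = - (c \<cdot> p)"
  "c \<cdot> 0 = 0" "0 \<cdot> p = 0" "1 \<cdot> p = p" "c \<cdot> d \<cdot> p = (c * d) \<cdot> p" "(- c) \<cdot> p = - (c \<cdot> p)"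
  by (auto intro!: poly_mapping_eqI simp: lookup_add lookup_minus algebra_simps)

lemma scale_left_distrib: "(c + d) \<cdot> p = c \<cdot> p + d \<cdot> p"
  by (auto intro!: poly_mapping_eqI simp: lookup_add algebra_simps)

lemma scale_sum: "c \<cdot> sum f A = (\<Sum>a\<in>A. c \<cdot> f a)"
  by (auto intro!: poly_mapping_eqI simp: lookup_sum sum_distrib_left)

lemma scale_single: "c \<cdot> Poly_Mapping.single w d = Poly_Mapping.single w (c * d)"
  by (auto intro!: poly_mapping_eqI simp: lookup_single when_def)

lemma monom_word_Nil: "monom_word [] = 1"
  by (simp add: monom_word_def zero_word_def[symmetric])

lemma monom_word_append: "monom_word (u @ w) = monom_word u * monom_word w"
  by (simp add: monom_word_def mult_single plus_word_def)

lemma keys_monom_word [simp]: "Poly_Mapping.keys (monom_word w) = {Word w}"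
  by (simp add: monom_word_def)

lemma lookup_monom_word:
  "Poly_Mapping.lookup (monom_word u) w = (if w = Word u then 1 else 0)"
  by (auto simp: monom_word_def lookup_single when_def)

lemma keys_scale: "Poly_Mapping.keys (c \<cdot> p) \<subseteq> Poly_Mapping.keys p"
  by (auto simp: in_keys_iff)

lemma keys_minus': "Poly_Mapping.keys (p - p') \<subseteq> Poly_Mapping.keys p \<union> Poly_Mapping.keys p'"
  by (auto simp: in_keys_iff lookup_minus)

lemma poly_mapping_expand:
  fixes p :: "'g word \<Rightarrow>\<^sub>0 K"
  shows "p = (\<Sum>w\<in>Poly_Mapping.keys p. Poly_Mapping.lookup p w \<cdot> monom_word (letters w))"
proof (rule poly_mapping_eqI)
  fix k :: "'g word"
  have "Poly_Mapping.lookup (\<Sum>w\<in>Poly_Mapping.keys p. Poly_Mapping.lookup p w \<cdot> monom_word (letters w)) k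
      = (\<Sum>w\<in>Poly_Mapping.keys p. if k = w then Poly_Mapping.lookup p w else 0)"
    unfolding lookup_sum lookup_scale lookup_monom_word
    by (intro sum.cong) (auto simp: word.expand)
  then show "Poly_Mapping.lookup p k =
      Poly_Mapping.lookup (\<Sum>w\<in>Poly_Mapping.keys p. Poly_Mapping.lookup p w \<cdot> monom_word (letters w)) k"
    by (simp add: in_keys_iff)
qed

text \<open>Each element is the finite sum of its terms. Fixing the set \<open>S\<close> of
  admissible words lets one rule serve both the free algebra on given letters and the tensor powers.
  The cases for sums and multiples carry no membership assumption; where membership matters it is
  made part of \<open>P\<close>.\<close>

lemma word_algebra_induct [consumes 1, case_names zero add scale monom]:
  fixes p :: "'g word \<Rightarrow>\<^sub>0 K"
  assumes "\<forall>w\<in>Poly_Mapping.keys p. letters w \<in> S"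
    and "P 0" and "\<And>a b. P a \<Longrightarrow> P b \<Longrightarrow> P (a + b)" and "\<And>c a. P a \<Longrightarrow> P (c \<cdot> a)"
    and "\<And>w. w \<in> S \<Longrightarrow> P (monom_word w)"
  shows "P p"
proof -
  have "finite A \<Longrightarrow> A \<subseteq> Poly_Mapping.keys p \<Longrightarrow>
      P (\<Sum>w\<in>A. Poly_Mapping.lookup p w \<cdot> monom_word (letters w))" for A
  proof (induction A rule: finite_induct)
    case (insert w A)
    then show ?case using assms by auto
  qed (use assms in simp)
  from this[OF finite_keys subset_refl] show ?thesis
    by (simp only: poly_mapping_expand[of p, symmetric])
qed

lemma scale_mult_left: "(c \<cdot> p) * q = c \<cdot> (p * q)" for p q :: "'g word \<Rightarrow>\<^sub>0 K"
  by (simp add: scale_def mult_map_scale_conv_mult mult.assoc)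

text \<open>Scaling is left multiplication by \<open>Poly_Mapping.single 0 c\<close>, so pulling a
  scalar out of the right factor needs this element to be central. It commutes with words because
  \<open>0\<close> is the empty word, and with coefficients because \<open>K\<close> is
  commutative.\<close>

lemma scale_mult_right: "p * (c \<cdot> q) = c \<cdot> (p * q)" for p q :: "'g word \<Rightarrow>\<^sub>0 K"
proof -
  have commute: "Poly_Mapping.single 0 c * p = p * Poly_Mapping.single 0 c"
  proof -
    have "\<forall>w\<in>Poly_Mapping.keys p. letters w \<in> UNIV" by simp
    then show ?thesis
    proof (induction p rule: word_algebra_induct)
      case (scale d a)
      have "Poly_Mapping.single 0 c * Poly_Mapping.single 0 d =
          (Poly_Mapping.single 0 d * Poly_Mapping.single 0 c :: 'g word \<Rightarrow>\<^sub>0 K)"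
        by (simp add: mult_single mult.commute)
      then have "Poly_Mapping.single 0 c * (Poly_Mapping.single 0 d * a) =
          Poly_Mapping.single 0 d * (Poly_Mapping.single 0 c * a)"
        by (simp only: mult.assoc[symmetric])
      then show ?case
        unfolding scale_def mult_map_scale_conv_mult by (simp only: scale mult.assoc)
    qed (auto simp: monom_word_def mult_single distrib_left distrib_right)
  qed
  then show ?thesis
    by (simp add: scale_def mult_map_scale_conv_mult flip: mult.assoc)
qed

section \<open>Linear extension from words\<close>

definition lin_ext :: "('g list \<Rightarrow> 'a \<Rightarrow>\<^sub>0 K) \<Rightarrow> ('g word \<Rightarrow>\<^sub>0 K) \<Rightarrow> 'a \<Rightarrow>\<^sub>0 K" where
  "lin_ext b p = (\<Sum>w\<in>Poly_Mapping.keys p. Poly_Mapping.lookup p w \<cdot> b (letters w))"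

text \<open>Cancellation can shrink the support of a sum, so additivity is proved by summing over
  one common finite set; terms outside the support contribute zero.\<close>

lemma lin_ext_superset:
  assumes "finite A" "Poly_Mapping.keys p \<subseteq> A"
  shows "lin_ext b p = (\<Sum>w\<in>A. Poly_Mapping.lookup p w \<cdot> b (letters w))"
  unfolding lin_ext_def using assms by (intro sum.mono_neutral_left) (auto simp: in_keys_iff)

lemma lin_ext_add [simp]: "lin_ext b (p + p') = lin_ext b p + lin_ext b p'"
proof -
  let ?A = "Poly_Mapping.keys p \<union> Poly_Mapping.keys p'"
  have "Poly_Mapping.keys (p + p') \<subseteq> ?A" by (rule keys_add)
  then show ?thesis
    by (simp add: lin_ext_superset[of ?A] lookup_add scale_left_distrib sum.distrib)
qed

lemma lin_ext_scale [simp]: "lin_ext b (c \<cdot> p) = c \<cdot> lin_ext b p"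
  by (subst lin_ext_superset[OF finite_keys keys_scale]) (simp add: scale_sum lin_ext_def)

lemma lin_ext_zero [simp]: "lin_ext b 0 = 0"
  by (simp add: lin_ext_def)

lemma lin_ext_monom [simp]: "lin_ext b (monom_word w) = b w"
  by (simp add: lin_ext_def lookup_monom_word)

lemma minus_conv_scale: "p - p' = p + (- 1) \<cdot> p'" for p p' :: "'a \<Rightarrow>\<^sub>0 K"
  by simp

section \<open>Subspaces, linear operators and evaluation of words\<close>

definition subspace :: "('a \<Rightarrow>\<^sub>0 K) set \<Rightarrow> bool" where
  "subspace W \<longleftrightarrow> 0 \<in> W \<and> (\<forall>u\<in>W. \<forall>v\<in>W. u + v \<in> W) \<and> (\<forall>c. \<forall>v\<in>W. c \<cdot> v \<in> W)"

lemma subspaceD: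
  assumes "subspace W"
  shows "0 \<in> W" "u \<in> W \<Longrightarrow> v \<in> W \<Longrightarrow> u + v \<in> W" "v \<in> W \<Longrightarrow> c \<cdot> v \<in> W"
    "u \<in> W \<Longrightarrow> v \<in> W \<Longrightarrow> u - v \<in> W"
proof -
  show "0 \<in> W" "u \<in> W \<Longrightarrow> v \<in> W \<Longrightarrow> u + v \<in> W" "v \<in> W \<Longrightarrow> c \<cdot> v \<in> W"
    using assms by (auto simp: subspace_def)
  show "u - v \<in> W" if "u \<in> W" "v \<in> W"
    unfolding minus_conv_scale[of u v] using assms that unfolding subspace_def by blast
qed

lemma lin_ext_closed:
  assumes "subspace W" "\<And>w. w \<in> Poly_Mapping.keys p \<Longrightarrow> b (letters w) \<in> W"
  shows "lin_ext b p \<in> W"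
proof -
  have "\<forall>w\<in>Poly_Mapping.keys p. letters w \<in> letters ` Poly_Mapping.keys p" by auto
  then show ?thesis
    by (induction p rule: word_algebra_induct) (use assms in \<open>auto intro: subspaceD\<close>)
qed

lemma End_algebra_simps:
  "\<phi> \<in> carrier (End_algebra W) \<longleftrightarrow> \<phi> \<in> W \<rightarrow>\<^sub>E W \<and> (\<forall>u\<in>W. \<forall>v\<in>W. \<phi> (u + v) = \<phi> u + \<phi> v) \<and>
     (\<forall>c. \<forall>v\<in>W. \<phi> (c \<cdot> v) = c \<cdot> \<phi> v)"
  "mult (End_algebra W) \<phi> \<psi> = (\<lambda>v\<in>W. \<phi> (\<psi> v))" "one (End_algebra W) = (\<lambda>v\<in>W. v)"
  "zero (End_algebra W) = (\<lambda>v\<in>W. 0)" "add (End_algebra W) \<phi> \<psi> = (\<lambda>v\<in>W. \<phi> v + \<psi> v)"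
  "smult (End_algebra W) c \<phi> = (\<lambda>v\<in>W. c \<cdot> \<phi> v)"
  by (auto simp: End_algebra_def ring.defs module.defs)

lemma End_algebraD:
  assumes "\<phi> \<in> carrier (End_algebra W)" "v \<in> W"
  shows "\<phi> v \<in> W" "u \<in> W \<Longrightarrow> \<phi> (u + v) = \<phi> u + \<phi> v" "\<phi> (c \<cdot> v) = c \<cdot> \<phi> v"
  using assms by (auto simp: End_algebra_simps)

lemma End_algebra_zero:
  assumes "\<phi> \<in> carrier (End_algebra W)" "subspace W"
  shows "\<phi> 0 = 0"
  using End_algebraD(3)[OF assms(1) subspaceD(1)[OF assms(2)], of 0] by simp

lemma zero_End_algebra: "subspace W \<Longrightarrow> (\<lambda>v\<in>W. 0) \<in> carrier (End_algebra W)"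
  by (auto simp: End_algebra_simps subspaceD)

lemma fold_End_algebra:
  assumes "\<And>g. \<phi> g \<in> carrier (End_algebra W)" "u \<in> W" "v \<in> W"
  shows "fold \<phi> ws v \<in> W" "fold \<phi> ws (u + v) = fold \<phi> ws u + fold \<phi> ws v"
    "fold \<phi> ws (c \<cdot> v) = c \<cdot> fold \<phi> ws v"
  using assms(2,3) by (induction ws arbitrary: u v) (auto simp: End_algebraD[OF assms(1)])

text \<open>The anti-homomorphism from the free algebra to \<^term>\<open>End_algebra W\<close> that extends \<open>\<phi>\<close>: the leftmost
  letter of a word acts first.\<close>

definition eval_word_alg ::
    "('g \<Rightarrow> ('a \<Rightarrow>\<^sub>0 K) \<Rightarrow> ('a \<Rightarrow>\<^sub>0 K)) \<Rightarrow> ('g word \<Rightarrow>\<^sub>0 K) \<Rightarrow> ('a \<Rightarrow>\<^sub>0 K) \<Rightarrow> ('a \<Rightarrow>\<^sub>0 K)" where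
  "eval_word_alg \<phi> p v = lin_ext (\<lambda>ws. fold \<phi> ws v) p"

lemma eval_simps [simp]:
  "eval_word_alg \<phi> (p + q) v = eval_word_alg \<phi> p v + eval_word_alg \<phi> q v"
  "eval_word_alg \<phi> (c \<cdot> p) v = c \<cdot> eval_word_alg \<phi> p v"
  "eval_word_alg \<phi> 0 v = 0" "eval_word_alg \<phi> 1 v = v"
  "eval_word_alg \<phi> (monom_word ws) v = fold \<phi> ws v"
  by (auto simp: eval_word_alg_def monom_word_Nil[symmetric])

lemma eval_diff [simp]: "eval_word_alg \<phi> (p - q) v = eval_word_alg \<phi> p v - eval_word_alg \<phi> q v"
  by (subst minus_conv_scale) (simp only: eval_simps, simp)

lemma eval_End_algebra:
  assumes "subspace W" "\<And>g. \<phi> g \<in> carrier (End_algebra W)"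
  shows "v \<in> W \<Longrightarrow> eval_word_alg \<phi> p v \<in> W"
    "u \<in> W \<Longrightarrow> v \<in> W \<Longrightarrow> eval_word_alg \<phi> p (u + v) = eval_word_alg \<phi> p u + eval_word_alg \<phi> p v"
    "v \<in> W \<Longrightarrow> eval_word_alg \<phi> p (c \<cdot> v) = c \<cdot> eval_word_alg \<phi> p v"
  unfolding eval_word_alg_def
  by (auto intro!: lin_ext_closed assms fold_End_algebra[where u=v and W=W])
    (auto simp: lin_ext_def scale_sum fold_End_algebra[OF assms(2)] sum.distrib mult.commute)

text \<open>Folding a concatenation applies the letters of \<open>p\<close> before those of
  \<open>q\<close>; this reversal makes evaluation an anti-homomorphism. Linearity in
  \<open>p\<close> of the right-hand side uses that evaluating \<open>q\<close> is linear on
  \<open>W\<close>, hence the assumption \<open>v \<in> W\<close>.\<close>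

lemma eval_mult:
  assumes "subspace W" "\<And>g. \<phi> g \<in> carrier (End_algebra W)" "v \<in> W"
  shows "eval_word_alg \<phi> (p * q) v = eval_word_alg \<phi> q (eval_word_alg \<phi> p v)"
proof -
  have "\<forall>w\<in>Poly_Mapping.keys p. letters w \<in> UNIV" by simp
  then show ?thesis
  proof (induction p rule: word_algebra_induct)
    case (monom u)
    have "\<forall>w\<in>Poly_Mapping.keys q. letters w \<in> UNIV" by simp
    then show ?case
      by (induction q rule: word_algebra_induct)
        (auto simp: distrib_left scale_mult_right monom_word_append[symmetric])
  next
    case zero
    show ?case using eval_End_algebra(3)[OF assms(1,2) subspaceD(1)[OF assms(1)], where c = 0] by simp
  qed (auto simp: distrib_right scale_mult_left eval_End_algebra[OF assms(1,2)] assms(3))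
qed

section \<open>The free algebra as a ring\<close>

lemma free_algebra_simps:
  "p \<in> carrier (free_algebra S) \<longleftrightarrow> (\<forall>w\<in>Poly_Mapping.keys p. set (letters w) \<subseteq> S)"
  "mult (free_algebra S) = (*)" "one (free_algebra S) = 1" "zero (free_algebra S) = 0"
  "add (free_algebra S) = (+)" "smult (free_algebra S) = scale"
  by (auto simp: free_algebra_def ring.defs module.defs)

lemma free_algebra_closed:
  "0 \<in> carrier (free_algebra S)" "1 \<in> carrier (free_algebra S)"
  "p \<in> carrier (free_algebra S) \<Longrightarrow> q \<in> carrier (free_algebra S) \<Longrightarrow> p + q \<in> carrier (free_algebra S)"
  "p \<in> carrier (free_algebra S) \<Longrightarrow> q \<in> carrier (free_algebra S) \<Longrightarrow> p - q \<in> carrier (free_algebra S)"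
  "p \<in> carrier (free_algebra S) \<Longrightarrow> q \<in> carrier (free_algebra S) \<Longrightarrow> p * q \<in> carrier (free_algebra S)"
  "p \<in> carrier (free_algebra S) \<Longrightarrow> c \<cdot> p \<in> carrier (free_algebra S)"
  "monom_word w \<in> carrier (free_algebra S) \<longleftrightarrow> set w \<subseteq> S"
  using keys_add[of p q] keys_minus'[of p q] keys_mult[of p q] keys_scale[of c p]
  unfolding free_algebra_simps
  by (simp_all add: zero_word_def) (blast, blast, fastforce simp: plus_word_def, blast)

lemma ring_free_algebra: "ring (free_algebra S)"
proof (rule ringI)
  show "abelian_group (free_algebra S)"
  proof (rule abelian_groupI)
    fix p assume p: "p \<in> carrier (free_algebra S)"
    have "(-1) \<cdot> p \<oplus>\<^bsub>free_algebra S\<^esub> p = \<zero>\<^bsub>free_algebra S\<^esub>" by (simp add: free_algebra_simps)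
    with p show "\<exists>y\<in>carrier (free_algebra S). y \<oplus>\<^bsub>free_algebra S\<^esub> p = \<zero>\<^bsub>free_algebra S\<^esub>"
      by (meson free_algebra_closed(6))
  qed (simp_all add: free_algebra_simps(2-) free_algebra_closed algebra_simps)
  show "monoid (free_algebra S)"
    by (rule monoidI) (simp_all add: free_algebra_simps(2-) free_algebra_closed mult.assoc)
qed (simp_all add: free_algebra_simps(2-) algebra_simps)

section \<open>Cosets of the relation ideal and the universal property\<close>

locale presentation =
  fixes S :: "'g set" and R :: "('g word \<Rightarrow>\<^sub>0 K) set"
  assumes relators: "R \<subseteq> carrier (free_algebra S)"
begin

sublocale I: ideal "rel_ideal S R" "free_algebra S"
  unfolding rel_ideal_def by (rule ring.genideal_ideal[OF ring_free_algebra relators])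

definition proj :: "('g word \<Rightarrow>\<^sub>0 K) \<Rightarrow> ('g word \<Rightarrow>\<^sub>0 K) set" where
  "proj p = rel_ideal S R +>\<^bsub>free_algebra S\<^esub> p"

lemma proj_simps:
  "presented_gen S R g = proj (var g)" "\<one>\<^bsub>presented_algebra S R\<^esub> = proj 1"
  "carrier (presented_algebra S R) = proj ` carrier (free_algebra S)"
  "p \<in> carrier (free_algebra S) \<Longrightarrow> q \<in> carrier (free_algebra S) \<Longrightarrow>
     proj p \<oplus>\<^bsub>presented_algebra S R\<^esub> proj q = proj (p + q)"
  "p \<in> carrier (free_algebra S) \<Longrightarrow> q \<in> carrier (free_algebra S) \<Longrightarrow>
     proj p \<otimes>\<^bsub>presented_algebra S R\<^esub> proj q = proj (p * q)"
  using I.a_rcos_sum[of p q] I.rcoset_mult_add[of p q]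
  by (auto simp: proj_def presented_gen_def presented_algebra_def ring.defs module.defs FactRing_def
      A_RCOSETS_def' free_algebra_simps(2-))

lemma proj_eq_iff:
  assumes "p \<in> carrier (free_algebra S)" "q \<in> carrier (free_algebra S)"
  shows "proj p = proj q \<longleftrightarrow> p - q \<in> rel_ideal S R"
proof -
  have "a_minus (free_algebra S) p q = p - q"
  proof -
    have "\<ominus>\<^bsub>free_algebra S\<^esub> q = - 1 \<cdot> q"
      by (rule I.minus_equality) (use assms in \<open>simp_all add: free_algebra_simps(2-) free_algebra_closed\<close>,
        metis free_algebra_closed(6) minus_conv_scale diff_0 scale_simps(6,8))
    then show ?thesis by (simp add: a_minus_def free_algebra_simps)
  qed
  then show ?thesis
    using I.quotient_eq_iff_same_a_r_cos[OF I.ideal_axioms assms] unfolding proj_def by simp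
qed

text \<open>The scalar action is a union over all representatives, so it is a single coset only if
  every representative yields the same one. The ideal absorbs multiplication by
  \<open>c \<cdot> 1\<close>, hence is closed under scalars.\<close>

lemma proj_smult:
  assumes "p \<in> carrier (free_algebra S)"
  shows "c \<odot>\<^bsub>presented_algebra S R\<^esub> proj p = proj (c \<cdot> p)"
proof -
  have mem: "p' \<in> proj p \<longleftrightarrow> p' \<in> carrier (free_algebra S) \<and> proj p' = proj p" for p'
  proof
    assume p': "p' \<in> proj p"
    then show "p' \<in> carrier (free_algebra S) \<and> proj p' = proj p"
      using I.a_r_coset_subset_G[OF I.a_subset assms] I.a_repr_independence'[OF _ assms]
      unfolding proj_def by auto
  next
    assume "p' \<in> carrier (free_algebra S) \<and> proj p' = proj p"
    then show "p' \<in> proj p" unfolding proj_def by (metis I.a_rcos_self)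
  qed
  have "proj (c \<cdot> p') = proj (c \<cdot> p)" if "p' \<in> proj p" for p'
  proof -
    have p': "p' \<in> carrier (free_algebra S)" "p' - p \<in> rel_ideal S R"
      using that mem assms proj_eq_iff by auto
    have "(c \<cdot> 1) \<otimes>\<^bsub>free_algebra S\<^esub> (p' - p) \<in> rel_ideal S R"
      by (intro I.I_l_closed p' free_algebra_closed)
    then have "c \<cdot> p' - c \<cdot> p \<in> rel_ideal S R" by (simp add: free_algebra_simps scale_mult_left)
    then show ?thesis by (subst proj_eq_iff) (use p'(1) assms in \<open>auto intro: free_algebra_closed\<close>)
  qed
  moreover have "c \<odot>\<^bsub>presented_algebra S R\<^esub> proj p = (\<Union>p'\<in>proj p. proj (c \<cdot> p'))"
    by (simp add: presented_algebra_def module.defs ring.defs proj_def)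
  moreover have "p \<in> proj p" using mem assms by simp
  ultimately show ?thesis
    by (metis (no_types, lifting) SUP_eq_const empty_iff)
qed

text \<open>Words in the generators span the free algebra, and anti-homomorphisms are extensional,
  so agreement on generators gives equality as functions.\<close>

lemma alg_antihom_ext:
  assumes h: "h \<in> alg_antihom (presented_algebra S R) B" "h' \<in> alg_antihom (presented_algebra S R) B"
    and eq: "\<And>g. g \<in> S \<Longrightarrow> h (presented_gen S R g) = h' (presented_gen S R g)"
  shows "h = h'"
proof -
  let ?A = "presented_algebra S R" and ?F = "free_algebra S"
  have monom: "h (proj (monom_word ws)) = h' (proj (monom_word ws))" if "set ws \<subseteq> S" for ws
    using that
  proof (induction ws)
    case Nil
    then show ?case using h by (simp add: monom_word_Nil alg_antihom_def flip: proj_simps(2))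
  next
    case (Cons g ws)
    have c: "monom_word ws \<in> carrier ?F" "var g \<in> carrier ?F"
      using Cons.prems by (auto simp: free_algebra_closed)
    have "proj (monom_word (g # ws)) = proj (var g) \<otimes>\<^bsub>?A\<^esub> proj (monom_word ws)"
      using monom_word_append[of "[g]" ws] c by (simp add: proj_simps)
    then show ?case
      using h Cons eq[of g] c proj_simps(3) by (auto simp: alg_antihom_def proj_simps(1))
  qed
  have *: "p \<in> carrier ?F \<and> h (proj p) = h' (proj p)" if "p \<in> carrier ?F" for p
  proof -
    have "\<forall>w\<in>Poly_Mapping.keys p. letters w \<in> {ws. set ws \<subseteq> S}"
      using that by (auto simp: free_algebra_simps)
    then show ?thesis
    proof (induction p rule: word_algebra_induct)
      case zero
      \<comment> \<open>\<open>alg_antihom\<close> does not list preservation of zero, so the zero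
        coset is reached as the multiple by 0 of the unit coset.\<close>
      have "proj 0 = 0 \<odot>\<^bsub>?A\<^esub> proj 0" by (simp add: proj_smult free_algebra_closed)
      moreover have "h (0 \<odot>\<^bsub>?A\<^esub> proj 1) = h' (0 \<odot>\<^bsub>?A\<^esub> proj 1)"
      proof -
        have "proj 1 \<in> carrier ?A" using proj_simps(3) free_algebra_closed(2) by blast
        then show ?thesis using h monom[of "[]"] by (auto simp: alg_antihom_def monom_word_Nil)
      qed
      ultimately show ?case by (simp add: proj_smult free_algebra_closed)
    next
      case (add a b)
      then have "proj a \<in> carrier ?A" "proj b \<in> carrier ?A" using proj_simps(3) by auto
      moreover have "proj (a + b) = proj a \<oplus>\<^bsub>?A\<^esub> proj b" using add proj_simps by simp
      ultimately show ?case using add h by (auto simp: alg_antihom_def free_algebra_closed)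
    next
      case (scale c a)
      then have "proj a \<in> carrier ?A" using proj_simps(3) by auto
      moreover have "proj (c \<cdot> a) = c \<odot>\<^bsub>?A\<^esub> proj a" using scale proj_smult by simp
      ultimately show ?case using scale h by (auto simp: alg_antihom_def free_algebra_closed)
    qed (auto simp: monom free_algebra_closed)
  qed
  show ?thesis
  proof (rule extensionalityI[of _ "carrier ?A"])
    show "h \<in> extensional (carrier ?A)" "h' \<in> extensional (carrier ?A)"
      using h unfolding alg_antihom_def PiE_def by blast+
  qed (use * proj_simps(3) in auto)
qed

text \<open>The elements whose evaluation vanishes on \<open>W\<close> form a two-sided ideal; it
  contains the relators, hence \<open>rel_ideal S R\<close>, and evaluation factors through the
  quotient. \<open>\<phi>\<close> is total, so letters outside \<open>S\<close> must be given
  operators too.\<close>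

lemma alg_antihom_exists:
  assumes W: "subspace W" and \<phi>: "\<And>g. \<phi> g \<in> carrier (End_algebra W)"
    and R0: "\<And>p v. p \<in> R \<Longrightarrow> v \<in> W \<Longrightarrow> eval_word_alg \<phi> p v = 0"
  shows "\<exists>h\<in>alg_antihom (presented_algebra S R) (End_algebra W).
    \<forall>p\<in>carrier (free_algebra S). h (proj p) = (\<lambda>v\<in>W. eval_word_alg \<phi> p v)"
proof -
  let ?A = "presented_algebra S R" and ?F = "free_algebra S"
  let ?N = "{p \<in> carrier ?F. \<forall>v\<in>W. eval_word_alg \<phi> p v = 0}"
  note E = eval_End_algebra[OF W \<phi>] and M = eval_mult[OF W \<phi>]
  have E0: "eval_word_alg \<phi> p 0 = 0" for p using E(3)[OF subspaceD(1)[OF W], where c = 0] by simp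
  have "ideal ?N ?F"
  proof (rule idealI[OF ring_free_algebra])
    show "subgroup ?N (add_monoid ?F)"
    proof (rule group.subgroupI)
      show "group (add_monoid ?F)" by (rule I.add.is_group)
    next
      fix p assume p: "p \<in> ?N"
      have "inv\<^bsub>add_monoid ?F\<^esub> p = (-1) \<cdot> p"
        by (rule group.inv_equality[OF I.add.is_group])
          (use p free_algebra_closed(6)[of p S "-1"] in \<open>simp_all add: free_algebra_simps(2-)\<close>)
      moreover have "eval_word_alg \<phi> ((-1) \<cdot> p) v = 0" if "v \<in> W" for v
        using p that by (subst eval_simps(2)) simp
      ultimately show "inv\<^bsub>add_monoid ?F\<^esub> p \<in> ?N"
        using p free_algebra_closed(6)[of p S "-1"] by simp
    next
      show "?N \<noteq> {}" using free_algebra_closed(1) by (auto intro!: exI[of _ 0])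
    next
      fix p q assume "p \<in> ?N" "q \<in> ?N"
      then show "p \<otimes>\<^bsub>add_monoid ?F\<^esub> q \<in> ?N"
        by (simp add: free_algebra_closed free_algebra_simps(5))
    qed auto
  next
    fix p x assume "p \<in> ?N" "x \<in> carrier ?F"
    then show "x \<otimes>\<^bsub>?F\<^esub> p \<in> ?N" "p \<otimes>\<^bsub>?F\<^esub> x \<in> ?N"
      by (simp_all add: free_algebra_closed free_algebra_simps(2) M E(1) E0)
  qed
  moreover have "R \<subseteq> ?N" using relators R0 by auto
  ultimately have N: "rel_ideal S R \<subseteq> ?N"
    unfolding rel_ideal_def by (rule I.genideal_minimal)
  \<comment> \<open>The chosen representative is immaterial: two representatives of a coset differ
    by an element of \<open>?N\<close>, so they evaluate alike.\<close>
  define h where "h = (\<lambda>C\<in>carrier ?A. \<lambda>v\<in>W. eval_word_alg \<phi> (SOME p. p \<in> carrier ?F \<and> proj p = C) v)"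
  have h: "h (proj p) = (\<lambda>v\<in>W. eval_word_alg \<phi> p v)" if p: "p \<in> carrier ?F" for p
  proof -
    define p' where "p' = (SOME p'. p' \<in> carrier ?F \<and> proj p' = proj p)"
    have p': "p' \<in> carrier ?F \<and> proj p' = proj p"
      unfolding p'_def by (rule someI[of _ p]) (use p in simp)
    then have "p' - p \<in> ?N" using N p proj_eq_iff by blast
    then have "\<forall>v\<in>W. eval_word_alg \<phi> p' v = eval_word_alg \<phi> p v" by simp
    then show ?thesis using p unfolding h_def p'_def proj_simps(3) by auto
  qed
  have "h \<in> alg_antihom ?A (End_algebra W)"
    unfolding alg_antihom_def
  proof (intro CollectI conjI ballI allI)
    show "h \<in> carrier ?A \<rightarrow>\<^sub>E carrier (End_algebra W)"
      by (rule PiE_I) (auto simp: proj_simps(3) h End_algebra_simps(1) E subspaceD(2,3)[OF W] h_def)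
  qed (auto simp: proj_simps proj_smult h free_algebra_closed End_algebra_simps(2-) E(1) M
      intro!: restrict_ext)
  with h show ?thesis by blast
qed

end

section \<open>Reduced expressions in the symmetric group\<close>

fun word_perm :: "nat list \<Rightarrow> nat \<Rightarrow> nat" where
  "word_perm [] = id"
| "word_perm (i # w) = simple_refl i \<circ> word_perm w"

lemma expression_iff: "expression l \<sigma> w \<longleftrightarrow> set w \<subseteq> {1..<l} \<and> word_perm w = \<sigma>"
proof -
  have "foldr (\<lambda>i \<tau>. simple_refl i \<circ> \<tau>) w id = word_perm w" by (induction w) auto
  then show ?thesis by (simp add: expression_def)
qed

lemma word_perm_snoc: "word_perm (u @ [i]) = word_perm u \<circ> simple_refl i"
  by (induction u) (simp_all add: o_assoc)

lemma simple_refl_involutory [simp]: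
  "simple_refl i (simple_refl i x) = x" "f \<circ> simple_refl i \<circ> simple_refl i = f"
  by (auto simp: simple_refl_def fun_eq_iff)

lemma simple_refl_permutes: "i \<in> {1..<l} \<Longrightarrow> simple_refl i permutes {1..l}"
  unfolding simple_refl_def by (rule permutes_swap_id) auto

lemma word_perm_permutes: "set w \<subseteq> {1..<l} \<Longrightarrow> word_perm w permutes {1..l}"
proof (induction w)
  case (Cons i w)
  then have "set w \<subseteq> {1..<l}" "i \<in> {1..<l}" by auto
  then have "simple_refl i \<circ> word_perm w permutes {1..l}"
    by (intro permutes_compose simple_refl_permutes Cons.IH)
  then show ?case unfolding word_perm.simps .
qed (simp add: permutes_id)

section \<open>Inversions and length\<close>

definition inversions :: "(nat \<Rightarrow> nat) \<Rightarrow> (nat \<times> nat) set" where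
  "inversions \<sigma> = {(a, b). a < b \<and> \<sigma> b < \<sigma> a}"

text \<open>\<open>inversions\<close> ranges over all pairs of naturals, and an infinite set would
  have cardinality 0. Since \<open>\<sigma>\<close> preserves \<open>{1..l}\<close> and fixes
  everything else, an inverted pair lies inside this interval.\<close>

lemma finite_inversions:
  assumes \<sigma>: "\<sigma> permutes {1..l}"
  shows "finite (inversions \<sigma>)"
proof (rule finite_subset)
  show "inversions \<sigma> \<subseteq> {1..l} \<times> {1..l}"
  proof (clarify, unfold inversions_def, clarify)
    fix a b assume ab: "a < b" "\<sigma> b < \<sigma> a"
    have fix_out: "\<sigma> x = x" if "x \<notin> {1..l}" for x using \<sigma> that by (simp add: permutes_def)
    have in_l: "\<sigma> x \<in> {1..l} \<longleftrightarrow> x \<in> {1..l}" for x using permutes_in_image[OF \<sigma>] .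
    show "a \<in> {1..l} \<and> b \<in> {1..l}"
      using ab fix_out[of a] fix_out[of b] in_l[of a] in_l[of b] by (auto simp: not_le)
  qed
qed simp

lemma inversions_id [simp]: "inversions id = {}"
  by (auto simp: inversions_def)

text \<open>The reflection keeps the order of every increasing pair but \<open>(i, Suc i)\<close>.
  Precomposing therefore relabels the old inversions and creates exactly this pair.\<close>

lemma inversions_comp_simple_refl:
  assumes "\<sigma> i < \<sigma> (Suc i)"
  shows "inversions (\<sigma> \<circ> simple_refl i) =
    insert (i, Suc i) (map_prod (simple_refl i) (simple_refl i) ` inversions \<sigma>)"
proof -
  let ?s = "simple_refl i"
  have mono: "?s a < ?s b" if "a < b" "(a, b) \<noteq> (i, Suc i)" for a b
    using that by (auto simp: simple_refl_def transpose_def)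
  show ?thesis
  proof (intro equalityI subsetI)
    fix x assume "x \<in> inversions (\<sigma> \<circ> ?s)"
    then obtain a b where x: "x = (a, b)" "a < b" "\<sigma> (?s b) < \<sigma> (?s a)"
      by (auto simp: inversions_def)
    show "x \<in> insert (i, Suc i) (map_prod ?s ?s ` inversions \<sigma>)"
    proof (cases "x = (i, Suc i)")
      case False
      then have "(?s a, ?s b) \<in> inversions \<sigma>" using x mono by (auto simp: inversions_def)
      then have "map_prod ?s ?s (?s a, ?s b) \<in> map_prod ?s ?s ` inversions \<sigma>" by (rule imageI)
      then show ?thesis using x by simp
    qed simp
  next
    fix x assume "x \<in> insert (i, Suc i) (map_prod ?s ?s ` inversions \<sigma>)"
    then show "x \<in> inversions (\<sigma> \<circ> ?s)"
    proof
      assume "x = (i, Suc i)"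
      then show ?thesis using assms by (simp add: inversions_def simple_refl_def)
    next
      assume "x \<in> map_prod ?s ?s ` inversions \<sigma>"
      then obtain a b where x: "x = (?s a, ?s b)" "a < b" "\<sigma> b < \<sigma> a"
        by (auto simp: inversions_def)
      moreover from x assms have "(a, b) \<noteq> (i, Suc i)" by auto
      ultimately show ?thesis using mono by (auto simp: inversions_def)
    qed
  qed
qed

text \<open>The added pair is new: its preimage under the reflection is the decreasing pair
  \<open>(Suc i, i)\<close>, which cannot be an inversion.\<close>

lemma card_inversions_ascent:
  assumes "\<sigma> permutes {1..l}" "\<sigma> i < \<sigma> (Suc i)"
  shows "card (inversions (\<sigma> \<circ> simple_refl i)) = Suc (card (inversions \<sigma>))"
proof -
  let ?s = "simple_refl i"
  have "(i, Suc i) \<notin> map_prod ?s ?s ` inversions \<sigma>"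
  proof
    assume "(i, Suc i) \<in> map_prod ?s ?s ` inversions \<sigma>"
    then obtain a b where ab: "a < b" "?s a = i" "?s b = Suc i"
      by (fastforce simp: inversions_def)
    then have "a = ?s i" "b = ?s (Suc i)" by (metis simple_refl_involutory(1))+
    with \<open>a < b\<close> show False by (simp add: simple_refl_def)
  qed
  moreover have "inj ?s" by (simp add: simple_refl_def)
  then have "inj_on (map_prod ?s ?s) (inversions \<sigma>)"
    by (meson inj_on_subset prod.inj_map subset_UNIV)
  ultimately show ?thesis
    using finite_inversions[OF assms(1)] by (simp add: inversions_comp_simple_refl[OF assms(2)] card_image)
qed

lemma card_inversions_descent:
  assumes "\<sigma> permutes {1..l}" "\<sigma> (Suc i) < \<sigma> i" "i \<in> {1..<l}"
  shows "card (inversions \<sigma>) = Suc (card (inversions (\<sigma> \<circ> simple_refl i)))"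
  using card_inversions_ascent[of "\<sigma> \<circ> simple_refl i" l i] assms
    permutes_compose[OF simple_refl_permutes[OF assms(3)] assms(1)]
  unfolding simple_refl_involutory(2) by (simp add: simple_refl_def)

lemma ascent_or_descent:
  assumes "\<sigma> permutes {1..l}"
  shows "\<sigma> i < \<sigma> (Suc i) \<or> \<sigma> (Suc i) < \<sigma> i"
  using permutes_inj[OF assms] by (metis injD n_not_Suc_n nat_neq_iff)

lemma card_inversions_le_length:
  assumes "set w \<subseteq> {1..<l}"
  shows "card (inversions (word_perm w)) \<le> length w"
  using assms
proof (induction w rule: rev_induct)
  case (snoc i w)
  then have p: "word_perm w permutes {1..l}" using word_perm_permutes by simp
  have "card (inversions (word_perm w \<circ> simple_refl i)) \<le> Suc (card (inversions (word_perm w)))"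
    using ascent_or_descent[OF p, of i] card_inversions_ascent[OF p, of i]
      card_inversions_descent[OF p, of i] snoc.prems by auto
  moreover have "card (inversions (word_perm w)) \<le> length w"
    by (rule snoc.IH) (use snoc.prems in simp)
  ultimately show ?case by (simp add: word_perm_snoc o_def)
qed simp

lemma permutes_no_descent:
  assumes \<sigma>: "\<sigma> permutes {1..l}" and asc: "\<And>i. i \<in> {1..<l} \<Longrightarrow> \<sigma> i < \<sigma> (Suc i)"
  shows "\<sigma> = id"
proof (rule permutes_natset_ge[OF \<sigma>], rule ballI)
  fix k assume "k \<in> {1..l}"
  then show "k \<le> \<sigma> k"
  proof (induction k)
    case (Suc k)
    show ?case
    proof (cases "k = 0")
      case True
      then show ?thesis using Suc.prems permutes_in_image[OF \<sigma>, of "Suc k"] by auto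
    next
      case False
      then show ?thesis using Suc asc[of k] by auto
    qed
  qed simp
qed

text \<open>Bubble sort: composing with the reflection at a descent lowers the number of inversions
  by one, and without descents the permutation is the identity.\<close>

lemma expression_card_inversions:
  assumes "\<sigma> permutes {1..l}"
  shows "\<exists>w. expression l \<sigma> w \<and> length w = card (inversions \<sigma>)"
  using assms
proof (induction "card (inversions \<sigma>)" arbitrary: \<sigma> rule: less_induct)
  case less
  show ?case
  proof (cases "\<exists>i\<in>{1..<l}. \<sigma> (Suc i) < \<sigma> i")
    case True
    then obtain i where i: "i \<in> {1..<l}" "\<sigma> (Suc i) < \<sigma> i" by blast
    note card = card_inversions_descent[OF less.prems i(2,1)]
    have "\<sigma> \<circ> simple_refl i permutes {1..l}"
      using less.prems i(1) by (intro permutes_compose simple_refl_permutes)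
    then obtain w where w: "expression l (\<sigma> \<circ> simple_refl i) w"
        "length w = card (inversions (\<sigma> \<circ> simple_refl i))"
      using less.hyps card by auto
    then have "expression l \<sigma> (w @ [i])" unfolding expression_iff word_perm_snoc using i by auto
    then show ?thesis using w card by (intro exI[of _ "w @ [i]"]) simp
  next
    case False
    then have "\<sigma> = id" using less.prems ascent_or_descent[OF less.prems] by (intro permutes_no_descent[of \<sigma> l]) blast+
    then show ?thesis by (intro exI[of _ "[]"]) (simp add: expression_iff)
  qed
qed

text \<open>Trades the minimum in \<open>len\<close> for a count, so that comparing the lengths of
  \<open>\<sigma>\<close> and \<open>\<sigma> \<circ> simple_refl i\<close> amounts to comparing two
  values of \<open>\<sigma>\<close>. Each letter changes the count by at most one, which gives
  minimality.\<close>

lemma len_eq_card_inversions: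
  assumes "\<sigma> permutes {1..l}"
  shows "len l \<sigma> = card (inversions \<sigma>)"
  unfolding len_def
  by (rule Least_equality)
    (use expression_card_inversions[OF assms] in \<open>auto simp: expression_iff intro!: card_inversions_le_length\<close>)

section \<open>Reduced expressions and Matsumoto's theorem\<close>

lemma reduced_expression_exists:
  assumes "\<sigma> permutes {1..l}"
  obtains w where "reduced_expression l \<sigma> w"
  using expression_card_inversions[OF assms] len_eq_card_inversions[OF assms]
  by (auto simp: reduced_expression_def)

lemma reduced_expression_permutes: "reduced_expression l \<sigma> w \<Longrightarrow> \<sigma> permutes {1..l}"
  unfolding reduced_expression_def expression_iff using word_perm_permutes by blast

lemma reduced_expression_snocD:
  assumes "reduced_expression l \<sigma> (u @ [i])"
  shows "i \<in> {1..<l}" "reduced_expression l (\<sigma> \<circ> simple_refl i) u" "\<sigma> (Suc i) < \<sigma> i"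
proof -
  note \<sigma> = reduced_expression_permutes[OF assms]
  have u: "set u \<subseteq> {1..<l}" "i \<in> {1..<l}" "word_perm u = \<sigma> \<circ> simple_refl i"
    "Suc (length u) = card (inversions \<sigma>)"
    using assms len_eq_card_inversions[OF \<sigma>]
    by (auto simp: reduced_expression_def expression_iff word_perm_snoc)
  have p: "\<sigma> \<circ> simple_refl i permutes {1..l}" using word_perm_permutes[OF u(1)] u(3) by simp
  have le: "card (inversions (\<sigma> \<circ> simple_refl i)) \<le> length u"
    using card_inversions_le_length[OF u(1)] u(3) by simp
  \<comment> \<open>An ascent at \<open>i\<close> would give
    \<open>\<sigma> \<circ> simple_refl i\<close> more inversions than the length of
    \<open>u\<close> allows.\<close>
  then show desc: "\<sigma> (Suc i) < \<sigma> i"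
    using ascent_or_descent[OF \<sigma>, of i] card_inversions_ascent[OF \<sigma>, of i] u(4) by auto
  show "i \<in> {1..<l}" by (fact u(2))
  show "reduced_expression l (\<sigma> \<circ> simple_refl i) u"
    using u card_inversions_descent[OF \<sigma> desc u(2)] len_eq_card_inversions[OF p]
    by (simp add: reduced_expression_def expression_iff)
qed

lemma reduced_expression_snocI:
  assumes "\<sigma> permutes {1..l}" "i \<in> {1..<l}" "\<sigma> (Suc i) < \<sigma> i"
    "reduced_expression l (\<sigma> \<circ> simple_refl i) z"
  shows "reduced_expression l \<sigma> (z @ [i])"
  using assms card_inversions_descent[OF assms(1,3,2)] len_eq_card_inversions[OF assms(1)]
    len_eq_card_inversions[OF reduced_expression_permutes[OF assms(4)]]
  unfolding reduced_expression_def expression_iff word_perm_snoc by auto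

text \<open>Two reduced expressions of \<open>\<sigma>\<close> ending in distinct letters are compared with reduced expressions
  that both end in the longest element of the parabolic subgroup generated by these letters.\<close>

theorem matsumoto:
  fixes a :: "nat \<Rightarrow> 'v \<Rightarrow> 'v"
  assumes closed: "\<And>i v. i \<in> {1..<l} \<Longrightarrow> v \<in> W \<Longrightarrow> a i v \<in> W"
    and braid: "\<And>i v. i \<in> {1..<l} \<Longrightarrow> Suc i \<in> {1..<l} \<Longrightarrow> v \<in> W \<Longrightarrow>
      a i (a (Suc i) (a i v)) = a (Suc i) (a i (a (Suc i) v))"
    and commute: "\<And>i j v. i \<in> {1..<l} \<Longrightarrow> j \<in> {1..<l} \<Longrightarrow> Suc i < j \<Longrightarrow> v \<in> W \<Longrightarrow>
      a i (a j v) = a j (a i v)"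
    and w: "reduced_expression l \<sigma> w" "reduced_expression l \<sigma> w'" and v: "v \<in> W"
  shows "fold a w v = fold a w' v"
  using w
proof (induction "length w" arbitrary: \<sigma> w w' rule: less_induct)
  case less
  note \<sigma> = reduced_expression_permutes[OF less.prems(1)]
  \<comment> \<open>The claim is symmetric in the two expressions, so the last letters may be taken
    in order; the opposite order is covered at the end by exchanging the roles.\<close>
  have step: "fold a (u @ [i]) v = fold a (u' @ [j]) v"
    if u: "reduced_expression l \<sigma> (u @ [i])" "reduced_expression l \<sigma> (u' @ [j])"
      and lw: "length (u @ [i]) = length w" and "i \<le> j" for u i u' j
  proof -
    note D = reduced_expression_snocD[OF u(1)] and D' = reduced_expression_snocD[OF u(2)]
    have lw': "length (u' @ [j]) = length w" using u lw by (simp add: reduced_expression_def)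
    have perm: "\<sigma> \<circ> simple_refl i permutes {1..l}" "\<sigma> \<circ> simple_refl j permutes {1..l}"
      using D(2) D'(2) by (auto dest: reduced_expression_permutes)
    \<comment> \<open>The relations between the operators are assumed on \<open>W\<close> only, so
      the vector obtained from the common prefix \<open>z\<close> has to stay in
      \<open>W\<close>.\<close>
    have fold_z: "fold a z v \<in> W" if "set z \<subseteq> {1..<l}" for z
      using that v by (induction z rule: rev_induct) (auto intro: closed)
    consider "i = j" | "Suc i < j" | "j = Suc i" using \<open>i \<le> j\<close> by linarith
    then show ?thesis
    proof cases
      case 1
      then have "fold a u v = fold a u' v" using less.hyps[OF _ D(2), of u'] D'(2) lw by auto
      then show ?thesis using 1 by simp
    next
      case 2
      have eq: "\<sigma> \<circ> simple_refl j \<circ> simple_refl i = \<sigma> \<circ> simple_refl i \<circ> simple_refl j"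
        using 2 by (auto simp: fun_eq_iff simple_refl_def transpose_def)
      have "\<sigma> \<circ> simple_refl i \<circ> simple_refl j permutes {1..l}"
        by (intro permutes_compose simple_refl_permutes perm D' )
      then obtain z where z: "reduced_expression l (\<sigma> \<circ> simple_refl i \<circ> simple_refl j) z"
        using reduced_expression_exists by blast
      have "reduced_expression l (\<sigma> \<circ> simple_refl i) (z @ [j])"
        by (rule reduced_expression_snocI[OF perm(1) D'(1) _ z])
          (use 2 D'(3) in \<open>auto simp: simple_refl_def transpose_def\<close>)
      then have 1: "fold a u v = fold a (z @ [j]) v" using less.hyps[OF _ D(2)] lw by auto
      have "reduced_expression l (\<sigma> \<circ> simple_refl j) (z @ [i])"
        by (rule reduced_expression_snocI[OF perm(2) D(1) _ z[folded eq]])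
          (use 2 D(3) in \<open>auto simp: simple_refl_def transpose_def\<close>)
      then have "fold a u' v = fold a (z @ [i]) v" using less.hyps[OF _ D'(2)] lw' by auto
      with 1 show ?thesis
        using commute[OF D(1) D'(1) 2 fold_z, of z] z
        by (auto simp: reduced_expression_def expression_iff)
    next
      case 3
      let ?s = "simple_refl i" and ?t = "simple_refl (Suc i)"
      \<comment> \<open>The braid identity for reflections: one word \<open>z\<close> for this
        permutation extends to reduced expressions of both \<open>\<sigma> \<circ> ?s\<close> and
        \<open>\<sigma> \<circ> ?t\<close>.\<close>
      have eq: "\<sigma> \<circ> ?t \<circ> ?s \<circ> ?t = \<sigma> \<circ> ?s \<circ> ?t \<circ> ?s"
        by (auto simp: fun_eq_iff simple_refl_def transpose_def)
      have j: "Suc i \<in> {1..<l}" using D'(1) 3 by simp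
      note perm = perm[unfolded 3]
      have perm2: "\<sigma> \<circ> ?s \<circ> ?t permutes {1..l}" "\<sigma> \<circ> ?t \<circ> ?s permutes {1..l}"
        by (intro permutes_compose simple_refl_permutes perm D(1) j)+
      have "\<sigma> \<circ> ?s \<circ> ?t \<circ> ?s permutes {1..l}"
        by (intro permutes_compose simple_refl_permutes perm2 D(1))
      then obtain z where z: "reduced_expression l (\<sigma> \<circ> ?s \<circ> ?t \<circ> ?s) z"
        using reduced_expression_exists by blast
      \<comment> \<open>\<open>\<sigma>\<close> decreases along three consecutive points, which
        makes every letter appended to \<open>z\<close> below a descent.\<close>
      have desc: "\<sigma> (Suc i) < \<sigma> i" "\<sigma> (Suc (Suc i)) < \<sigma> (Suc i)" using D(3) D'(3) 3 by auto
      have "reduced_expression l (\<sigma> \<circ> ?s \<circ> ?t) (z @ [i])"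
        by (rule reduced_expression_snocI[OF perm2(1) D(1) _ z])
          (use desc in \<open>auto simp: simple_refl_def transpose_def\<close>)
      then have "reduced_expression l (\<sigma> \<circ> ?s) ((z @ [i]) @ [Suc i])"
        by (rule reduced_expression_snocI[OF perm(1) j, rotated])
          (use desc in \<open>auto simp: simple_refl_def transpose_def\<close>)
      then have 1: "fold a u v = fold a ((z @ [i]) @ [Suc i]) v" using less.hyps[OF _ D(2)] lw by auto
      have "reduced_expression l (\<sigma> \<circ> ?t \<circ> ?s) (z @ [Suc i])"
        by (rule reduced_expression_snocI[OF perm2(2) j _ z[folded eq]])
          (use desc in \<open>auto simp: simple_refl_def transpose_def\<close>)
      then have "reduced_expression l (\<sigma> \<circ> ?t) ((z @ [Suc i]) @ [i])"
        by (rule reduced_expression_snocI[OF perm(2) D(1), rotated])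
          (use desc in \<open>auto simp: simple_refl_def transpose_def\<close>)
      then have "fold a u' v = fold a ((z @ [Suc i]) @ [i]) v"
        using less.hyps[OF _ D'(2)] lw' 3 by auto
      with 1 show ?thesis
        using braid[OF D(1) j fold_z, of z] z 3
        by (auto simp: reduced_expression_def expression_iff)
    qed
  qed
  have len: "length w' = length w" using less.prems by (simp add: reduced_expression_def)
  show ?case
  proof (cases w rule: rev_cases)
    case Nil
    then show ?thesis using len by simp
  next
    case (snoc u i)
    then obtain u' j where w': "w' = u' @ [j]" using len by (cases w' rule: rev_cases) auto
    show ?thesis
      using step[of u i u' j] step[of u' j u i] less.prems snoc w' len by (metis nle_le)
  qed
qed

section \<open>The Hecke relations on tensor space\<close>

lemma monom_word_in_tensor_power [simp]:
  "monom_word f \<in> tensor_power J n \<longleftrightarrow> f \<in> tuples J n"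
  by (simp add: tensor_power_def)

lemma subspace_tensor_power: "subspace (tensor_power J n)"
proof -
  have "u + v \<in> tensor_power J n" if "u \<in> tensor_power J n" "v \<in> tensor_power J n" for u v
    using that keys_add[of u v] unfolding tensor_power_def by blast
  moreover have "c \<cdot> v \<in> tensor_power J n" if "v \<in> tensor_power J n" for c v
    using that keys_scale[of c v] unfolding tensor_power_def by blast
  moreover have "0 \<in> tensor_power J n" by (simp add: tensor_power_def)
  ultimately show ?thesis unfolding subspace_def by blast
qed

lemma tensor_power_induct [consumes 1, case_names zero add scale monom]:
  assumes "v \<in> tensor_power J n"
    and "P 0" and "\<And>a b. P a \<Longrightarrow> P b \<Longrightarrow> P (a + b)" and "\<And>c a. P a \<Longrightarrow> P (c \<cdot> a)"
    and "\<And>f. f \<in> tuples J n \<Longrightarrow> P (monom_word f)"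
  shows "P v"
  using assms word_algebra_induct[of v "tuples J n" P] by (auto simp: tensor_power_def)

lemma gen_act_eq_lin_ext: "gen_act J n i = restrict (lin_ext (basis_act i)) (tensor_power J n)"
  by (simp add: gen_act_def lin_ext_def[abs_def])

lemma qq_nonzero: "qq \<noteq> 0"
  unfolding qq_def Zero_fract_def by (subst eq_fract) auto

lemma tuple_s_0: "tuple_s 0 (a # w) = (- a) # w"
  by (simp add: tuple_s_def)

lemma tuple_s_Suc: "tuple_s (Suc (length u)) (u @ a # b # w) = u @ b # a # w"
  by (simp add: tuple_s_def nth_append list_update_append)

text \<open>A name keeps this scalar opaque to the simplifier in the case distinctions on basis
  tensors; the square rule for \<open>inverse qq\<close> is all they use about it.\<close>

definition qdiff :: K where
  "qdiff = inverse qq - qq"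

text \<open>\<open>inverse qq\<close> is a root of the quadratic relation. The second form applies
  the rule inside a product nested to the right.\<close>

lemma inverse_qq_square:
  "inverse qq * inverse qq = 1 + qdiff * inverse qq"
  "inverse qq * (inverse qq * x) = x + qdiff * (inverse qq * x)"
proof -
  show 1: "inverse qq * inverse qq = 1 + qdiff * inverse qq"
    by (simp add: qdiff_def left_diff_distrib qq_nonzero)
  show "inverse qq * (inverse qq * x) = x + qdiff * (inverse qq * x)"
    by (simp only: mult.assoc[symmetric] 1 distrib_right mult_1_left)
qed

lemma basis_act_0:
  "basis_act 0 (a # w) =
    (if a > 0 then monom_word ((- a) # w)
     else monom_word ((- a) # w) + qdiff \<cdot> monom_word (a # w))"
  by (simp add: basis_act_def tuple_s_0 qdiff_def)

text \<open>Splitting the tuple exposes the two entries that are compared. Lists count from 0, so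
  generator \<open>Suc k\<close> acts on the entries right after a prefix of length
  \<open>k\<close>.\<close>

lemma basis_act_Suc:
  assumes "length u = k"
  shows "basis_act (Suc k) (u @ a # b # w) =
    (if a = b then inverse qq \<cdot> monom_word (u @ a # b # w)
     else if a < b then monom_word (u @ b # a # w)
     else monom_word (u @ b # a # w) + qdiff \<cdot> monom_word (u @ a # b # w))"
  using assms tuple_s_Suc[of u a b w] by (auto simp: basis_act_def nth_append qdiff_def)

lemma split_at_Suc:
  assumes "Suc i < length f"
  obtains u a b w where "f = u @ a # b # w" "length u = i"
proof -
  have "f = take i f @ f ! i # f ! Suc i # drop (Suc (Suc i)) f"
    using assms by (simp add: Cons_nth_drop_Suc)
  then show ?thesis using that assms by fastforce
qed

lemma tuples_split_at_Suc:
  assumes "f \<in> tuples J n" "Suc i < n"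
  obtains u a b w where "f = u @ a # b # w" "length u = i"
proof -
  have "Suc i < length f" using assms by (simp add: tuples_def)
  then show ?thesis using split_at_Suc that by blast
qed

lemma tuple_s_closed:
  assumes "uminus ` J \<subseteq> J" "f \<in> tuples J n" "i < n"
  shows "tuple_s i f \<in> tuples J n"
proof (cases i)
  case 0
  then show ?thesis using assms by (cases f) (auto simp: tuples_def tuple_s_0)
next
  case (Suc k)
  then obtain u a b w where "f = u @ a # b # w" "length u = k"
    using assms tuples_split_at_Suc[of f J n k] by blast
  then show ?thesis using assms Suc tuple_s_Suc[of u] by (auto simp: tuples_def)
qed

lemma basis_act_closed:
  assumes "uminus ` J \<subseteq> J" "f \<in> tuples J n" "i < n"
  shows "basis_act i f \<in> tensor_power J n"
  using assms tuple_s_closed[OF assms]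
  by (auto simp: basis_act_def intro!: subspaceD[OF subspace_tensor_power])

lemma lin_ext_basis_act_closed:
  assumes "uminus ` J \<subseteq> J" "i < n" "v \<in> tensor_power J n"
  shows "lin_ext (basis_act i) v \<in> tensor_power J n"
  using assms by (intro lin_ext_closed basis_act_closed subspace_tensor_power) (auto simp: tensor_power_def)

lemma gen_act_End:
  assumes "uminus ` J \<subseteq> J" "i < n"
  shows "gen_act J n i \<in> carrier (End_algebra (tensor_power J n))"
  using subspaceD[OF subspace_tensor_power[of J n]] lin_ext_basis_act_closed[OF assms]
  by (auto simp: gen_act_eq_lin_ext End_algebra_simps)

section \<open>The Hecke relations on basis tensors\<close>

context
  fixes J :: "rat set" and n :: nat
  assumes no_zero: "0 \<notin> J"
begin

text \<open>On the span of M_f and the tensor of the altered tuple the operator is a matrix of size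
  at most two. A first entry 0 would be its own negative and make M_f an eigenvector of generator 0
  for \<open>1 + qdiff\<close>, which violates the relation; this is why \<open>J\<close> must avoid
  0.\<close>

lemma basis_act_quadratic:
  assumes "i < n" "v \<in> tensor_power J n"
  shows "lin_ext (basis_act i) (lin_ext (basis_act i) v) =
    v + qdiff \<cdot> lin_ext (basis_act i) v"
  using assms(2)
proof (induction v rule: tensor_power_induct)
  case (monom f)
  show ?case
  proof (cases i)
    case 0
    then obtain a w where f: "f = a # w" using monom assms(1) by (cases f) (auto simp: tuples_def)
    then have "a \<noteq> 0" using monom no_zero by (auto simp: tuples_def)
    then show ?thesis using 0 f by (cases "a > 0") (simp_all add: basis_act_0 add.commute)
  next
    case (Suc k)
    then obtain u a b w where f: "f = u @ a # b # w" "length u = k"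
      using assms(1) tuples_split_at_Suc[OF monom, of k] by blast
    show ?thesis
      unfolding Suc f(1) by (cases a b rule: linorder_cases)
        (simp_all add: basis_act_Suc[OF f(2)] inverse_qq_square scale_left_distrib algebra_simps)
  qed
qed (auto simp: algebra_simps)

lemma basis_act_braid:
  assumes "0 < i" "Suc i < n" "v \<in> tensor_power J n"
  shows "lin_ext (basis_act i) (lin_ext (basis_act (Suc i)) (lin_ext (basis_act i) v)) =
    lin_ext (basis_act (Suc i)) (lin_ext (basis_act i) (lin_ext (basis_act (Suc i)) v))"
  using assms(3)
proof (induction v rule: tensor_power_induct)
  case (monom f)
  obtain k where i: "i = Suc k" using assms(1) gr0_implies_Suc by blast
  obtain u a b w where f: "f = u @ a # b # w" "length u = k"
    using assms(2) i tuples_split_at_Suc[OF monom, of k] by (metis Suc_lessD)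
  obtain c w' where w: "w = c # w'"
    using monom assms(2) i f by (cases w) (auto simp: tuples_def)
  have act: "basis_act (Suc k) (u @ x # y # z # w') =
      (if x = y then inverse qq \<cdot> monom_word (u @ x # y # z # w')
       else if x < y then monom_word (u @ y # x # z # w')
       else monom_word (u @ y # x # z # w') + qdiff \<cdot> monom_word (u @ x # y # z # w'))"
    "basis_act (Suc (Suc k)) (u @ x # y # z # w') =
      (if y = z then inverse qq \<cdot> monom_word (u @ x # y # z # w')
       else if y < z then monom_word (u @ x # z # y # w')
       else monom_word (u @ x # z # y # w') + qdiff \<cdot> monom_word (u @ x # y # z # w'))"
    for x y z
    using basis_act_Suc[of u k x y "z # w'"] basis_act_Suc[of "u @ [x]" "Suc k" y z w'] f by simp_all
  \<comment> \<open>The thirteen weak orderings of three entries; each decides every comparison made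
    along both sides.\<close>
  consider "a < b" "b < c" | "a < c" "c < b" | "b < a" "a < c" | "b < c" "c < a" | "c < a" "a < b"
    | "c < b" "b < a" | "a = b" "b < c" | "a = b" "c < b" | "a < b" "b = c" | "b < a" "b = c"
    | "a = c" "b < c" | "a = c" "c < b" | "a = b" "b = c"
    by (metis linorder_less_linear)
  then show ?case
    unfolding i f(1) w lin_ext_monom act
    by cases (simp_all add: act inverse_qq_square scale_left_distrib algebra_simps)
qed auto

text \<open>The two generators touch disjoint entries. Generator 0 is treated apart because it
  negates one entry instead of swapping two.\<close>

lemma basis_act_commute:
  assumes "Suc i < j" "j < n" "v \<in> tensor_power J n"
  shows "lin_ext (basis_act i) (lin_ext (basis_act j) v) = lin_ext (basis_act j) (lin_ext (basis_act i) v)"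
  using assms(3)
proof (induction v rule: tensor_power_induct)
  case (monom f)
  obtain l where j: "j = Suc l" using assms(1) by (cases j) auto
  obtain u c d w where f: "f = u @ c # d # w" "length u = l"
    using assms(2) j tuples_split_at_Suc[OF monom, of l] by blast
  show ?case
  proof (cases i)
    case 0
    obtain a u' where u: "u = a # u'" using f assms 0 j by (cases u) auto
    have act: "basis_act j (x # u' @ y # z # w) =
      (if y = z then inverse qq \<cdot> monom_word (x # u' @ y # z # w)
       else if y < z then monom_word (x # u' @ z # y # w)
       else monom_word (x # u' @ z # y # w) + qdiff \<cdot> monom_word (x # u' @ y # z # w))"
      for x y z
      using basis_act_Suc[of "x # u'" l y z w] f u j by simp
    show ?thesis unfolding f(1) u 0
      by (cases "a > 0"; cases c d rule: linorder_cases)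
        (simp_all add: act basis_act_0 add_ac mult_ac)
  next
    case (Suc k)
    have "Suc k < length u" using f assms(1) Suc j by simp
    then obtain u1 a b u2 where u: "u = u1 @ a # b # u2" "length u1 = k"
      using split_at_Suc by blast
    have act: "basis_act j (u1 @ x' # x # u2 @ y # z # w) =
      (if y = z then inverse qq \<cdot> monom_word (u1 @ x' # x # u2 @ y # z # w)
       else if y < z then monom_word (u1 @ x' # x # u2 @ z # y # w)
       else monom_word (u1 @ x' # x # u2 @ z # y # w) +
         qdiff \<cdot> monom_word (u1 @ x' # x # u2 @ y # z # w))"
      for x' x y z
      using basis_act_Suc[of "u1 @ x' # x # u2" l y z w] f u j by simp
    show ?thesis unfolding f(1) u(1) Suc
      by (cases a b rule: linorder_cases; cases c d rule: linorder_cases)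
        (simp_all add: act basis_act_Suc[OF u(2)] add_ac mult_ac)
  qed
qed auto

lemma basis_act_braid_0:
  assumes "1 < n" "v \<in> tensor_power J n"
  shows "lin_ext (basis_act 0) (lin_ext (basis_act 1) (lin_ext (basis_act 0) (lin_ext (basis_act 1) v))) =
    lin_ext (basis_act 1) (lin_ext (basis_act 0) (lin_ext (basis_act 1) (lin_ext (basis_act 0) v)))"
  using assms(2)
proof (induction v rule: tensor_power_induct)
  case (monom f)
  then obtain a b w where f: "f = a # b # w"
    using assms(1) by (cases f; cases "tl f") (auto simp: tuples_def)
  have nz: "a \<noteq> 0" "b \<noteq> 0" using monom f no_zero by (auto simp: tuples_def)
  have act: "basis_act (Suc 0) (x # y # w) =
      (if x = y then inverse qq \<cdot> monom_word (x # y # w)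
       else if x < y then monom_word (y # x # w)
       else monom_word (y # x # w) + qdiff \<cdot> monom_word (x # y # w))" for x y
    using basis_act_Suc[of "[]" 0 x y w] by simp
  \<comment> \<open>With sign changes, the comparisons on both sides depend only on the signs of
    \<open>a\<close> and \<open>b\<close> and on how \<open>a\<close> compares with \<open>b\<close>
    and with \<open>- b\<close>; inconsistent combinations are discarded arithmetically.\<close>
  have "a < 0 \<or> 0 < a" "b < 0 \<or> 0 < b" using nz by linarith+
  then show ?case
    unfolding f lin_ext_monom One_nat_def
    by (elim disjE; cases a b rule: linorder_cases; cases a "- b" rule: linorder_cases;
        (linarith | simp add: act basis_act_0 inverse_qq_square scale_left_distrib algebra_simps))
qed auto

end

section \<open>The action of the Hecke algebra\<close>

lemma lin_ext_diff [simp]: "lin_ext b (p - p') = lin_ext b p - lin_ext b p'"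
  by (subst minus_conv_scale) (simp only: lin_ext_add lin_ext_scale, simp)

lemma scale_left_diff_distrib: "(c - d) \<cdot> p = c \<cdot> p - d \<cdot> p"
  by (rule poly_mapping_eqI) (simp add: lookup_minus left_diff_distrib)

lemma hecke_relators_closed:
  assumes "\<And>i. i < n \<Longrightarrow> c i \<in> S"
  shows "hecke_relators n (\<lambda>i. var (c i)) \<subseteq> carrier (free_algebra S)"
  using assms unfolding hecke_relators_def
  by (auto intro!: free_algebra_closed(2-6) simp: free_algebra_closed(7))

text \<open>The universal property wants an operator for every letter of the type. Indices from
  \<open>n\<close> on get the zero operator, which is linear and is never met by words over the
  actual generators; \<open>duplex_act\<close> treats invalid letters likewise.\<close>

definition act_on :: "rat set \<Rightarrow> nat \<Rightarrow> nat \<Rightarrow> (rat word \<Rightarrow>\<^sub>0 K) \<Rightarrow> (rat word \<Rightarrow>\<^sub>0 K)" where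
  "act_on J n i = (if i < n then gen_act J n i else (\<lambda>v\<in>tensor_power J n. 0))"

lemma restrict_gen_act: "restrict (gen_act J n i) (tensor_power J n) = gen_act J n i"
  by (rule ext) (simp add: gen_act_def)

locale tensor_module =
  fixes J :: "rat set" and n :: nat
  assumes neg_closed: "uminus ` J \<subseteq> J" and no_zero: "0 \<notin> J"
begin

lemma act_on_End: "act_on J n i \<in> carrier (End_algebra (tensor_power J n))"
  using gen_act_End[OF neg_closed] zero_End_algebra[OF subspace_tensor_power] by (simp add: act_on_def)

text \<open>The generators carry arbitrary names \<open>c i\<close>, so one check serves both
  \<open>hecke\<close> itself and the \<open>T_gen\<close> part of the duplex algebra.\<close>

lemma hecke_relators_vanish:
  assumes \<phi>: "\<And>g. \<phi> g \<in> carrier (End_algebra (tensor_power J n))"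
    and c: "\<And>i. i < n \<Longrightarrow> \<phi> (c i) = gen_act J n i"
    and p: "p \<in> hecke_relators n (\<lambda>i. var (c i))" and v: "v \<in> tensor_power J n"
  shows "eval_word_alg \<phi> p v = 0"
proof -
  let ?B = "\<lambda>i. lin_ext (basis_act i)"
  have B: "?B i u \<in> tensor_power J n" if "i < n" "u \<in> tensor_power J n" for i u
    using lin_ext_basis_act_closed[OF neg_closed that] .
  have E: "eval_word_alg \<phi> (var (c i)) u = ?B i u" if "i < n" "u \<in> tensor_power J n" for i u
    using that c by (simp add: gen_act_eq_lin_ext)
  note M = eval_mult[OF subspace_tensor_power \<phi>]
  note sub = subspaceD[OF subspace_tensor_power]
  consider i where "i < n" "p = (var (c i) - inverse qq \<cdot> 1) * (var (c i) + qq \<cdot> 1)"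
    | i where "1 \<le> i" "i + 1 < n"
        "p = var (c i) * var (c (i + 1)) * var (c i) - var (c (i + 1)) * var (c i) * var (c (i + 1))"
    | i j where "i < n" "j < n" "i + 1 < j \<or> j + 1 < i"
        "p = var (c i) * var (c j) - var (c j) * var (c i)"
    | "1 < n" "p = var (c 0) * var (c 1) * var (c 0) * var (c 1)
        - var (c 1) * var (c 0) * var (c 1) * var (c 0)"
    using p unfolding hecke_relators_def by blast
  then show ?thesis
  proof cases
    case (1 i)
    have "eval_word_alg \<phi> p v = ?B i (?B i v) - inverse qq \<cdot> ?B i v + qq \<cdot> ?B i v - (qq * inverse qq) \<cdot> v"
      using 1 v by (simp add: M E B sub del: eval_simps(5))
    also have "\<dots> = 0"
      unfolding basis_act_quadratic[OF no_zero 1(1) v]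
      by (simp add: qdiff_def qq_nonzero scale_left_diff_distrib)
    finally show ?thesis .
  next
    case (2 i)
    then show ?thesis using basis_act_braid[OF no_zero, of i n v] v
      by (simp add: M E B del: eval_simps(5))
  next
    case (3 i j)
    then show ?thesis
      using basis_act_commute[OF no_zero, of i j n v] basis_act_commute[OF no_zero, of j i n v] v
      by (auto simp: M E B simp del: eval_simps(5))
  next
    case 4
    then show ?thesis using basis_act_braid_0[OF no_zero, of n v] v
      by (simp add: M E B del: eval_simps(5))
  qed
qed

sublocale hecke: presentation "{..<n}" "hecke_relators n var"
  by unfold_locales (rule hecke_relators_closed, simp)

text \<open>The definite description is resolved here: existence is the vanishing of the relators,
  uniqueness is agreement on generators. The second clause computes \<open>Psi\<close> on every
  coset.\<close>

lemma Psi_spec: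
  "Psi J n \<in> alg_antihom (hecke n) (End_algebra (tensor_power J n))"
  "p \<in> carrier (free_algebra {..<n}) \<Longrightarrow>
     Psi J n (hecke.proj p) = (\<lambda>v\<in>tensor_power J n. eval_word_alg (act_on J n) p v)"
proof -
  let ?W = "tensor_power J n"
  have "eval_word_alg (act_on J n) p v = 0" if "p \<in> hecke_relators n var" "v \<in> ?W" for p v
    by (rule hecke_relators_vanish[OF act_on_End, where c = "\<lambda>i. i"])
      (use that in \<open>simp_all add: act_on_def\<close>)
  then obtain h where h: "h \<in> alg_antihom (hecke n) (End_algebra ?W)"
    "\<And>p. p \<in> carrier (free_algebra {..<n}) \<Longrightarrow> h (hecke.proj p) = (\<lambda>v\<in>?W. eval_word_alg (act_on J n) p v)"
    using hecke.alg_antihom_exists[where \<phi> = "act_on J n", OF subspace_tensor_power act_on_End]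
    unfolding hecke_def by blast
  have h_gen: "h (H_gen n i) = gen_act J n i" if "i < n" for i
  proof -
    have "h (H_gen n i) = (\<lambda>v\<in>?W. act_on J n i v)"
      using h(2)[of "var i"] that by (simp add: H_gen_def hecke.proj_simps(1) free_algebra_closed)
    also have "\<dots> = gen_act J n i" using that by (simp add: act_on_def restrict_gen_act)
    finally show ?thesis .
  qed
  have "Psi J n = h"
    unfolding Psi_def
  proof (rule the_equality)
    fix \<psi> assume \<psi>: "\<psi> \<in> alg_antihom (hecke n) (End_algebra ?W) \<and> (\<forall>i<n. \<psi> (H_gen n i) = gen_act J n i)"
    show "\<psi> = h"
      by (rule hecke.alg_antihom_ext[of _ "End_algebra ?W"])
        (use \<psi> h(1) h_gen in \<open>simp_all add: hecke_def[symmetric] H_gen_def[symmetric]\<close>)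
  qed (use h(1) h_gen in blast)
  with h show "Psi J n \<in> alg_antihom (hecke n) (End_algebra (tensor_power J n))"
    "p \<in> carrier (free_algebra {..<n}) \<Longrightarrow>
     Psi J n (hecke.proj p) = (\<lambda>v\<in>tensor_power J n. eval_word_alg (act_on J n) p v)" by auto
qed

lemma Psi_H_gen:
  assumes "i < n"
  shows "Psi J n (H_gen n i) = gen_act J n i"
proof -
  have "Psi J n (H_gen n i) = (\<lambda>v\<in>tensor_power J n. act_on J n i v)"
    using Psi_spec(2)[of "var i"] assms by (simp add: H_gen_def hecke.proj_simps(1) free_algebra_closed)
  also have "\<dots> = gen_act J n i" using assms by (simp add: act_on_def restrict_gen_act)
  finally show ?thesis .
qed

lemma H_product_eq_proj:
  assumes "set w \<subseteq> {..<n}"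
  shows "foldr (\<lambda>i a. H_gen n i \<otimes>\<^bsub>hecke n\<^esub> a) w \<one>\<^bsub>hecke n\<^esub> = hecke.proj (monom_word w)"
  using assms
proof (induction w)
  case Nil
  show ?case by (simp add: hecke_def hecke.proj_simps(2) monom_word_Nil)
next
  case (Cons i w)
  then show ?case using monom_word_append[of "[i]" w]
    by (simp add: hecke_def[symmetric] hecke.proj_simps(1,5)[folded hecke_def] H_gen_def free_algebra_closed)
qed

lemma gen_act_closed: "i < n \<Longrightarrow> v \<in> tensor_power J n \<Longrightarrow> gen_act J n i v \<in> tensor_power J n"
  using gen_act_End[OF neg_closed] End_algebraD(1) by blast

lemma gen_act_quadratic:
  assumes "i < n" "v \<in> tensor_power J n"
  shows "gen_act J n i (gen_act J n i v) = v + qdiff \<cdot> gen_act J n i v"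
  using assms lin_ext_basis_act_closed[OF neg_closed assms] basis_act_quadratic[OF no_zero assms]
  by (simp add: gen_act_eq_lin_ext)

text \<open>Words for the symmetric group use indices from 1 on, and there the operators satisfy the
  braid and commutation relations that Matsumoto's theorem asks for.\<close>

lemma fold_gen_act_reduced_cong:
  assumes "reduced_expression n \<sigma> w" "reduced_expression n \<sigma> w'" "v \<in> tensor_power J n"
  shows "fold (gen_act J n) w v = fold (gen_act J n) w' v"
proof (rule matsumoto[OF _ _ _ assms])
  show "gen_act J n i v \<in> tensor_power J n" if "i \<in> {1..<n}" "v \<in> tensor_power J n" for i v
    using that by (simp add: gen_act_closed)
next
  fix i v assume "i \<in> {1..<n}" "Suc i \<in> {1..<n}" and v: "v \<in> tensor_power J n"
  then have i: "0 < i" "i < n" "Suc i < n" by auto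
  show "gen_act J n i (gen_act J n (Suc i) (gen_act J n i v)) =
      gen_act J n (Suc i) (gen_act J n i (gen_act J n (Suc i) v))"
    using basis_act_braid[OF no_zero i(1,3) v] lin_ext_basis_act_closed[OF neg_closed] i v
    by (simp add: gen_act_eq_lin_ext)
next
  fix i j v assume "i \<in> {1..<n}" "j \<in> {1..<n}" and i: "Suc i < j" and v: "v \<in> tensor_power J n"
  then have j: "i < n" "j < n" by auto
  show "gen_act J n i (gen_act J n j v) = gen_act J n j (gen_act J n i v)"
    using basis_act_commute[OF no_zero i j(2) v] lin_ext_basis_act_closed[OF neg_closed] j v
    by (simp add: gen_act_eq_lin_ext)
qed

section \<open>Action of the Hecke elements attached to permutations\<close>

abbreviation perm_act :: "(nat \<Rightarrow> nat) \<Rightarrow> (rat word \<Rightarrow>\<^sub>0 K) \<Rightarrow> (rat word \<Rightarrow>\<^sub>0 K)" where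
  "perm_act \<sigma> \<equiv> Psi J n (H_perm n \<sigma>)"

lemma H_perm_eq_proj:
  assumes "\<sigma> permutes {1..n}"
  obtains w where "reduced_expression n \<sigma> w" "H_perm n \<sigma> = hecke.proj (monom_word w)"
    "monom_word w \<in> carrier (free_algebra {..<n})" "set w \<subseteq> {1..<n}"
proof -
  define w where "w = (SOME w. reduced_expression n \<sigma> w)"
  have w: "reduced_expression n \<sigma> w"
    unfolding w_def by (rule someI_ex) (use reduced_expression_exists[OF assms] in blast)
  then have "set w \<subseteq> {1..<n}" by (simp add: reduced_expression_def expression_iff)
  moreover from this have "set w \<subseteq> {..<n}" by auto
  ultimately show ?thesis
    using that[OF w] H_product_eq_proj[of w] by (simp add: H_perm_def w_def free_algebra_closed(7))
qed

lemma perm_act_End: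
  assumes "\<sigma> permutes {1..n}"
  shows "perm_act \<sigma> \<in> carrier (End_algebra (tensor_power J n))"
proof -
  obtain w where w: "H_perm n \<sigma> = hecke.proj (monom_word w)"
    "monom_word w \<in> carrier (free_algebra {..<n})"
    using H_perm_eq_proj[OF assms] .
  then have "H_perm n \<sigma> \<in> carrier (hecke n)" by (simp add: hecke_def hecke.proj_simps(3))
  moreover have "Psi J n \<in> carrier (hecke n) \<rightarrow>\<^sub>E carrier (End_algebra (tensor_power J n))"
    using Psi_spec(1) unfolding alg_antihom_def by blast
  ultimately show ?thesis by (rule PiE_mem[rotated])
qed

text \<open>Frees the action from the expression chosen inside \<open>H_perm\<close>: any reduced
  expression computes it, so the one suited to a multiplication rule can be taken.\<close>

lemma perm_act_eq_fold:
  assumes w: "reduced_expression n \<sigma> w" and v: "v \<in> tensor_power J n"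
  shows "perm_act \<sigma> v = fold (gen_act J n) w v"
proof -
  obtain w' where w': "reduced_expression n \<sigma> w'" "H_perm n \<sigma> = hecke.proj (monom_word w')"
    "monom_word w' \<in> carrier (free_algebra {..<n})" "set w' \<subseteq> {1..<n}"
    using H_perm_eq_proj reduced_expression_permutes[OF w] by blast
  have "perm_act \<sigma> v = fold (act_on J n) w' v" using w' Psi_spec(2) v by simp
  also have "\<dots> = fold (gen_act J n) w' v"
    using w'(4) by (induction w' arbitrary: v) (auto simp: act_on_def)
  finally show ?thesis using fold_gen_act_reduced_cong[OF w'(1) w v] by simp
qed

lemma perm_act_simple_refl:
  assumes "i \<in> {1..<n}" "v \<in> tensor_power J n"
  shows "perm_act (simple_refl i) v = gen_act J n i v"
proof -
  have "simple_refl i \<circ> simple_refl i = id" by (simp add: fun_eq_iff)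
  then have "reduced_expression n (simple_refl i \<circ> simple_refl i) []"
    using len_eq_card_inversions[OF permutes_id[of "{1..n}"]]
    by (simp add: reduced_expression_def expression_iff)
  then have "reduced_expression n (simple_refl i) ([] @ [i])"
    by (intro reduced_expression_snocI simple_refl_permutes assms(1)) (simp_all add: simple_refl_def)
  from perm_act_eq_fold[OF this assms(2)] show ?thesis by simp
qed

text \<open>The length condition says that appending \<open>i\<close> keeps a reduced expression
  reduced. In a right action the last letter acts last, so right multiplication is composition from
  outside; in the mirrored rule the letter put in front acts first.\<close>

lemma perm_act_right_ascent:
  assumes "\<sigma> permutes {1..n}" "i \<in> {1..<n}" "len n (\<sigma> \<circ> simple_refl i) = len n \<sigma> + 1"
    and v: "v \<in> tensor_power J n"
  shows "gen_act J n i (perm_act \<sigma> v) = perm_act (\<sigma> \<circ> simple_refl i) v"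
proof -
  obtain w where w: "reduced_expression n \<sigma> w" using reduced_expression_exists[OF assms(1)] .
  then have "reduced_expression n (\<sigma> \<circ> simple_refl i) (w @ [i])"
    using assms by (simp add: reduced_expression_def expression_iff word_perm_snoc)
  with w v show ?thesis by (simp add: perm_act_eq_fold)
qed

lemma perm_act_left_ascent:
  assumes "\<sigma> permutes {1..n}" "i \<in> {1..<n}" "len n (simple_refl i \<circ> \<sigma>) = len n \<sigma> + 1"
    and v: "v \<in> tensor_power J n"
  shows "perm_act \<sigma> (gen_act J n i v) = perm_act (simple_refl i \<circ> \<sigma>) v"
proof -
  obtain w where w: "reduced_expression n \<sigma> w" using reduced_expression_exists[OF assms(1)] .
  then have "reduced_expression n (simple_refl i \<circ> \<sigma>) (i # w)"
    using assms by (simp add: reduced_expression_def expression_iff)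
  with w v assms(2) show ?thesis by (simp add: perm_act_eq_fold gen_act_closed)
qed

text \<open>The ascent rule rewrites the action of \<open>\<sigma>\<close> as that of the shorter
  permutation followed by the generator, and the quadratic relation then collapses the square of the
  generator.\<close>

lemma perm_act_right_descent:
  assumes \<sigma>: "\<sigma> permutes {1..n}" and i: "i \<in> {1..<n}"
    and len: "len n (\<sigma> \<circ> simple_refl i) + 1 = len n \<sigma>" and v: "v \<in> tensor_power J n"
  shows "gen_act J n i (perm_act \<sigma> v) = perm_act (\<sigma> \<circ> simple_refl i) v + qdiff \<cdot> perm_act \<sigma> v"
proof -
  have p: "\<sigma> \<circ> simple_refl i permutes {1..n}" by (intro permutes_compose simple_refl_permutes i \<sigma>)
  have "perm_act \<sigma> v = gen_act J n i (perm_act (\<sigma> \<circ> simple_refl i) v)"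
    using perm_act_right_ascent[OF p i _ v] len by simp
  moreover have "perm_act (\<sigma> \<circ> simple_refl i) v \<in> tensor_power J n"
    using perm_act_End[OF p] v by (rule End_algebraD)
  ultimately show ?thesis using gen_act_quadratic i by simp
qed

text \<open>Here the generator acts before the permutation, so the quadratic relation is applied to
  \<open>v\<close>, and linearity of the action of the shorter permutation carries it
  outward.\<close>

lemma perm_act_left_descent:
  assumes \<sigma>: "\<sigma> permutes {1..n}" and i: "i \<in> {1..<n}"
    and len: "len n (simple_refl i \<circ> \<sigma>) + 1 = len n \<sigma>" and v: "v \<in> tensor_power J n"
  shows "perm_act \<sigma> (gen_act J n i v) = perm_act (simple_refl i \<circ> \<sigma>) v + qdiff \<cdot> perm_act \<sigma> v"
proof -
  have p: "simple_refl i \<circ> \<sigma> permutes {1..n}" by (intro permutes_compose simple_refl_permutes i \<sigma>)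
  have inv: "simple_refl i \<circ> (simple_refl i \<circ> \<sigma>) = \<sigma>" by (simp add: fun_eq_iff)
  have eq: "perm_act \<sigma> u = perm_act (simple_refl i \<circ> \<sigma>) (gen_act J n i u)" if "u \<in> tensor_power J n" for u
    using perm_act_left_ascent[OF p i _ that] len inv by simp
  have g: "gen_act J n i v \<in> tensor_power J n" using gen_act_closed i v by simp
  have "perm_act \<sigma> (gen_act J n i v) = perm_act (simple_refl i \<circ> \<sigma>) (v + qdiff \<cdot> gen_act J n i v)"
    using eq[OF g] gen_act_quadratic[of i v] i v by simp
  also have "\<dots> = perm_act (simple_refl i \<circ> \<sigma>) v + qdiff \<cdot> perm_act (simple_refl i \<circ> \<sigma>) (gen_act J n i v)"
    using End_algebraD(2,3)[OF perm_act_End[OF p]] subspaceD(3)[OF subspace_tensor_power g] g v by simp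
  finally show ?thesis using eq[OF v] by simp
qed

end

section \<open>The action of the duplex Hecke algebra\<close>

lemma II_neg_closed: "uminus ` II n \<subseteq> II n"
proof
  fix x assume "x \<in> uminus ` II n"
  then obtain i where i: "i < n" "x = - (of_nat i - (of_nat n - 1) / 2)" by (auto simp: II_def)
  \<comment> \<open>Negation reverses the arithmetic progression.\<close>
  then have "x = of_nat (n - 1 - i) - (of_nat n - 1) / 2" by (simp add: of_nat_diff field_simps)
  then show "x \<in> II n" unfolding II_def by (rule image_eqI) (use i in auto)
qed

lemma zero_notin_II:
  assumes "even n"
  shows "0 \<notin> II n"
proof
  assume "0 \<in> II n"
  then obtain i where "(of_nat i :: rat) - (of_nat n - 1) / 2 = 0" by (auto simp: II_def)
  then have "(of_nat (2 * i + 1) :: rat) = of_nat n" by (simp add: field_simps)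
  then have "2 * i + 1 = n" by (simp only: of_nat_eq_iff)
  with assms show False by presburger
qed

lemma II_mono: "II (2 * r + 2) \<subseteq> II (2 * r + 4)"
proof
  fix x assume "x \<in> II (2 * r + 2)"
  then obtain i where "i < 2 * r + 2" "x = of_nat i - (of_nat (2 * r + 2) - 1) / 2" by (auto simp: II_def)
  then have "x = of_nat (Suc i) - (of_nat (2 * r + 4) - 1) / 2" "Suc i < 2 * r + 4"
    by (simp_all add: field_simps)
  then show "x \<in> II (2 * r + 4)" unfolding II_def by (intro image_eqI[where x = "Suc i"]) auto
qed

lemma top_in_II: "of_nat r + 3 / 2 \<in> II (2 * r + 4)"
  unfolding II_def by (rule image_eqI[where x = "2 * r + 3"]) (simp_all add: field_simps)

text \<open>Counting from 0, this value would have position \<open>2 * r + 2\<close> in the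
  progression, just past its end.\<close>

lemma top_notin_II: "of_nat r + 3 / 2 \<notin> II (2 * r + 2)"
proof
  assume "of_nat r + 3 / 2 \<in> II (2 * r + 2)"
  then obtain i where i: "i < 2 * r + 2" "(of_nat r :: rat) + 3 / 2 = of_nat i - (of_nat (2 * r + 2) - 1) / 2"
    by (auto simp: II_def)
  then have "(of_nat (2 * r + 2) :: rat) = of_nat i" by (simp add: field_simps)
  then have "2 * r + 2 = i" by (simp only: of_nat_eq_iff)
  with i show False by simp
qed

text \<open>Every entry that generator \<open>i\<close> reads or changes lies inside
  \<open>g\<close>.\<close>

lemma basis_act_append_left:
  assumes "i < length g"
  shows "basis_act i (g @ w) = basis_act i g * monom_word w"
proof -
  have nth: "(g @ w) ! i = g ! i" "(g @ w) ! (i - 1) = g ! (i - 1)" "(g @ w) ! 0 = g ! 0"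
    by (rule nth_append_left, use assms in linarith)+
  have lt: "i < length g" "i - 1 < length g" "0 < length g" using assms by auto
  have tuple_s: "tuple_s i (g @ w) = tuple_s i g @ w"
    unfolding tuple_s_def nth by (simp add: list_update_append1 list_update_append1[OF lt(3)] lt del: One_nat_def)
  show ?thesis
  proof (cases "i = 0")
    case True
    then show ?thesis using tuple_s nth
      by (simp add: basis_act_def monom_word_append distrib_right scale_mult_left)
  next
    case False
    then show ?thesis
      unfolding basis_act_def tuple_s nth
      by (simp add: monom_word_append distrib_right scale_mult_left)
  qed
qed

lemma eta_top_power: "eta_top r ^ k = monom_word (replicate k (of_nat r + 3 / 2))"
  by (induction k) (simp_all add: monom_word_Nil eta_top_def monom_word_append[symmetric])

lemma duplex_relators_closed: "duplex_relators m \<subseteq> carrier (free_algebra (duplex_gens m))"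
proof -
  have T: "var (T_gen i) \<in> carrier (free_algebra (duplex_gens m))" if "i < m" for i
    using that by (simp add: free_algebra_closed(7) duplex_gens_def)
  have x: "var (x_gen l \<sigma>) \<in> carrier (free_algebra (duplex_gens m))" if "l \<le> m" "\<sigma> permutes {1..l}" for l \<sigma>
    using that by (simp add: free_algebra_closed(7) duplex_gens_def)
  have hecke: "hecke_relators m (\<lambda>i. var (T_gen i)) \<subseteq> carrier (free_algebra (duplex_gens m))"
    by (rule hecke_relators_closed) (simp add: duplex_gens_def)
  have refl: "simple_refl i permutes {1..l}" if "0 < i" "i < l" for i l
    by (rule simple_refl_permutes) (use that in simp)
  show ?thesis
    unfolding duplex_relators_def Let_def
    by (intro Un_least hecke; clarify; intro free_algebra_closed(3-6) T x permutes_compose refl;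
        (assumption | linarith))
qed

section \<open>Basis tensors with a block in V followed by a constant tail\<close>

locale duplex_action =
  fixes r m :: nat
begin

abbreviation V where "V \<equiv> II (2 * r + 2)"
abbreviation U where "U \<equiv> II (2 * r + 4)"
abbreviation top_index :: rat where "top_index \<equiv> of_nat r + 3 / 2"
abbreviation tail :: "nat \<Rightarrow> rat word \<Rightarrow>\<^sub>0 K" where "tail l \<equiv> eta_top r ^ (m - l)"

sublocale U: tensor_module U m
  by unfold_locales (rule II_neg_closed, rule zero_notin_II, simp)

sublocale duplex: presentation "duplex_gens m" "duplex_relators m"
  by unfold_locales (rule duplex_relators_closed)

text \<open>The locale assumptions concern only the index set, so this one fact covers the tensor
  powers of \<open>V\<close> of every length.\<close>

lemma V_module: "tensor_module V"
  by unfold_locales (rule II_neg_closed, rule zero_notin_II, simp)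

text \<open>The entrywise form of \<open>monom_word f \<in> V_sub r m l\<close>, chosen because
  swaps are described by positions.\<close>

definition boxed :: "nat \<Rightarrow> rat list \<Rightarrow> bool" where
  "boxed l f \<longleftrightarrow> length f = m \<and> (\<forall>k<l. f ! k \<in> V) \<and> (\<forall>k. l \<le> k \<and> k < m \<longrightarrow> f ! k = top_index)"

lemma boxed_iff:
  assumes "l \<le> m"
  shows "boxed l f \<longleftrightarrow> (\<exists>g\<in>tuples V l. f = g @ replicate (m - l) top_index)"
proof
  assume f: "boxed l f"
  have "f = take l f @ replicate (m - l) top_index"
    by (rule nth_equalityI) (use f assms in \<open>auto simp: boxed_def nth_append\<close>)
  moreover have "take l f \<in> tuples V l"
    using f assms by (auto simp: boxed_def tuples_def in_set_conv_nth)
  ultimately show "\<exists>g\<in>tuples V l. f = g @ replicate (m - l) top_index" by blast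
next
  assume "\<exists>g\<in>tuples V l. f = g @ replicate (m - l) top_index"
  then obtain g where g: "set g \<subseteq> V" "length g = l" "f = g @ replicate (m - l) top_index"
    by (auto simp: tuples_def)
  then have "g ! k \<in> V" if "k < l" for k using that nth_mem by blast
  with g assms show "boxed l f" by (auto simp: boxed_def nth_append)
qed

text \<open>Otherwise the entry at position \<open>min l k\<close> would be both
  \<open>top_index\<close> and a member of \<open>V\<close>.\<close>

lemma boxed_unique:
  assumes "boxed l f" "boxed k f" "l \<le> m" "k \<le> m"
  shows "l = k"
proof (rule ccontr)
  assume "l \<noteq> k"
  then consider "l < k" | "k < l" by linarith
  then show False
  proof cases
    case 1
    then have "f ! l = top_index" "f ! l \<in> V" using assms by (auto simp: boxed_def)
    then show False using top_notin_II[of r] by metis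
  next
    case 2
    then have "f ! k = top_index" "f ! k \<in> V" using assms by (auto simp: boxed_def)
    then show False using top_notin_II[of r] by metis
  qed
qed

text \<open>Swapping at \<open>i\<close> exchanges two entries on the same side of the border unless
  \<open>i = l\<close>.\<close>

lemma boxed_tuple_s:
  assumes "boxed l f" "0 < i" "i \<noteq> l" "i < m" "l \<le> m"
  shows "boxed l (tuple_s i f)"
proof -
  obtain j where "i = Suc j" using assms(2) gr0_implies_Suc by blast
  with assms show ?thesis by (auto simp: boxed_def tuple_s_def nth_list_update le_Suc_eq)
qed

text \<open>Swapping twice is the identity, so a boxed image would force a boxed original.\<close>

lemma not_boxed_tuple_s:
  assumes "f \<in> tuples U m" "\<not> boxed l f" "0 < i" "i \<noteq> l" "i < m" "l \<le> m"
  shows "\<not> boxed l (tuple_s i f)"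
proof
  assume "boxed l (tuple_s i f)"
  then have "boxed l (tuple_s i (tuple_s i f))" by (rule boxed_tuple_s) (use assms in auto)
  moreover have "tuple_s i (tuple_s i f) = f"
    using assms by (intro nth_equalityI) (auto simp: tuple_s_def nth_list_update tuples_def)
  ultimately show False using assms by simp
qed

lemma monom_word_mult_tail: "monom_word g * tail l = monom_word (g @ replicate (m - l) top_index)"
  by (simp add: eta_top_power monom_word_append)

lemma mult_tail_closed:
  assumes "v \<in> tensor_power V l" "l \<le> m"
  shows "v * tail l \<in> tensor_power U m"
  using assms(1)
proof (induction v rule: tensor_power_induct)
  case (monom g)
  then show ?case using assms(2) II_mono[of r] top_in_II[of r]
    by (auto simp: monom_word_mult_tail tuples_def)
qed (use subspaceD[OF subspace_tensor_power[of U m]] in \<open>auto simp: distrib_right scale_mult_left\<close>)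

lemma monom_word_in_V_sub_iff:
  assumes "l \<le> m"
  shows "monom_word f \<in> V_sub r m l \<longleftrightarrow> boxed l f"
proof
  assume "monom_word f \<in> V_sub r m l"
  then obtain v where v: "v \<in> tensor_power V l" "monom_word f = v * tail l" by (auto simp: V_sub_def)
  \<comment> \<open>The linear projection that deletes boxed words: it kills all of
    \<open>V_sub r m l\<close>, but would fix the nonzero \<open>monom_word f\<close> if
    \<open>f\<close> were not boxed.\<close>
  let ?kill = "lin_ext (\<lambda>f. if boxed l f then 0 else monom_word f)"
  have "?kill (v * tail l) = 0"
    using v(1)
  proof (induction v rule: tensor_power_induct)
    case (monom g)
    then have "boxed l (g @ replicate (m - l) top_index)" using boxed_iff[OF assms] by blast
    then show ?case by (simp add: monom_word_mult_tail)
  qed (simp_all add: distrib_right scale_mult_left)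
  then have "?kill (monom_word f) = 0" using v(2) by simp
  moreover have "monom_word f \<noteq> 0" by (metis keys_monom_word keys_zero insert_not_empty)
  ultimately show "boxed l f" by (simp split: if_splits)
next
  assume "boxed l f"
  then obtain g where "g \<in> tuples V l" "f = g @ replicate (m - l) top_index"
    using boxed_iff[OF assms] by blast
  then have "monom_word g \<in> tensor_power V l" "monom_word f = monom_word g * tail l"
    by (simp_all add: monom_word_mult_tail)
  then show "monom_word f \<in> V_sub r m l" unfolding V_sub_def by blast
qed

text \<open>Boxed and unboxed basis tensors together span the space. The two conditions have the
  shape in which the values on \<open>x_elem\<close> are prescribed, so the criterion serves the
  relations as well as uniqueness.\<close>

lemma linear_eq_on_boxed:
  assumes W: "v \<in> tensor_power U m" and "l \<le> m"
    and F: "F \<in> carrier (End_algebra (tensor_power U m))" and G: "G \<in> carrier (End_algebra (tensor_power U m))"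
    and boxed: "\<And>v. v \<in> tensor_power V l \<Longrightarrow> F (v * tail l) = G (v * tail l)"
    and unboxed: "\<And>f. f \<in> tuples U m \<Longrightarrow> \<not> boxed l f \<Longrightarrow> F (monom_word f) = G (monom_word f)"
  shows "F v = G v"
proof -
  have "v \<in> tensor_power U m \<and> F v = G v"
    using W
  proof (induction v rule: tensor_power_induct)
    case zero
    then show ?case
      using End_algebra_zero[OF F subspace_tensor_power] End_algebra_zero[OF G subspace_tensor_power]
        subspaceD(1)[OF subspace_tensor_power] by simp
  next
    case (add a b)
    then show ?case
      using End_algebraD(2)[OF F] End_algebraD(2)[OF G] subspaceD(2)[OF subspace_tensor_power] by simp
  next
    case (scale c a)
    then show ?case
      using End_algebraD(3)[OF F] End_algebraD(3)[OF G] subspaceD(3)[OF subspace_tensor_power] by simp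
  next
    case (monom f)
    show ?case
    proof (cases "boxed l f")
      case True
      then obtain g where "g \<in> tuples V l" "f = g @ replicate (m - l) top_index"
        using boxed_iff[OF \<open>l \<le> m\<close>] by blast
      then show ?thesis using monom boxed[of "monom_word g"] by (simp add: monom_word_mult_tail)
    qed (use monom unboxed in simp)
  qed
  then show ?thesis ..
qed

text \<open>Defined on basis tensors, where \<open>take l f\<close> recovers the block in
  \<open>V\<close>; linearity is then automatic and no factorization of a general tensor has to be
  chosen.\<close>

definition x_act :: "nat \<Rightarrow> (nat \<Rightarrow> nat) \<Rightarrow> (rat word \<Rightarrow>\<^sub>0 K) \<Rightarrow> (rat word \<Rightarrow>\<^sub>0 K)" where
  "x_act l \<sigma> = (\<lambda>v\<in>tensor_power U m. lin_ext
     (\<lambda>f. if boxed l f then Psi V l (H_perm l \<sigma>) (monom_word (take l f)) * tail l else 0) v)"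

lemma x_act_boxed:
  assumes v: "v \<in> tensor_power V l" and "l \<le> m" "\<sigma> permutes {1..l}"
  shows "x_act l \<sigma> (v * tail l) = Psi V l (H_perm l \<sigma>) v * tail l"
proof -
  note P = tensor_module.perm_act_End[OF V_module assms(3)]
  let ?F = "lin_ext (\<lambda>f. if boxed l f then Psi V l (H_perm l \<sigma>) (monom_word (take l f)) * tail l else 0)"
  have "v \<in> tensor_power V l \<and> ?F (v * tail l) = Psi V l (H_perm l \<sigma>) v * tail l"
    using v
  proof (induction v rule: tensor_power_induct)
    case zero
    then show ?case
      using End_algebra_zero[OF P subspace_tensor_power] subspaceD(1)[OF subspace_tensor_power] by simp
  next
    case (add a b)
    then show ?case
      using End_algebraD(2)[OF P] subspaceD(2)[OF subspace_tensor_power] by (simp add: distrib_right)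
  next
    case (scale c a)
    then show ?case
      using End_algebraD(3)[OF P] subspaceD(3)[OF subspace_tensor_power] by (simp add: scale_mult_left)
  next
    case (monom g)
    then have "boxed l (g @ replicate (m - l) top_index)" "length g = l"
      using boxed_iff[OF \<open>l \<le> m\<close>] by (auto simp: tuples_def)
    then show ?case using monom by (simp add: monom_word_mult_tail)
  qed
  then show ?thesis using mult_tail_closed[OF v \<open>l \<le> m\<close>] by (simp add: x_act_def)
qed

lemma x_act_not_boxed: "f \<in> tuples U m \<Longrightarrow> \<not> boxed l f \<Longrightarrow> x_act l \<sigma> (monom_word f) = 0"
  by (simp add: x_act_def)

lemma x_act_End:
  assumes "l \<le> m" "\<sigma> permutes {1..l}"
  shows "x_act l \<sigma> \<in> carrier (End_algebra (tensor_power U m))"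
proof -
  note P = tensor_module.perm_act_End[OF V_module assms(2)]
  have "lin_ext (\<lambda>f. if boxed l f then Psi V l (H_perm l \<sigma>) (monom_word (take l f)) * tail l else 0) v
      \<in> tensor_power U m" if "v \<in> tensor_power U m" for v
  proof (rule lin_ext_closed[OF subspace_tensor_power])
    fix w
    have "Psi V l (H_perm l \<sigma>) (monom_word (take l f)) * tail l \<in> tensor_power U m" if "boxed l f" for f
    proof -
      have "take l f \<in> tuples V l" using that assms(1) boxed_iff by (auto simp: tuples_def)
      then show ?thesis using End_algebraD(1)[OF P] mult_tail_closed assms(1) by simp
    qed
    then show "(if boxed l (letters w) then Psi V l (H_perm l \<sigma>) (monom_word (take l (letters w))) * tail l
        else 0) \<in> tensor_power U m"
      using subspaceD(1)[OF subspace_tensor_power] by simp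
  qed
  then show ?thesis
    using subspaceD(2,3)[OF subspace_tensor_power[of U m]] by (simp add: End_algebra_simps(1) x_act_def)
qed

lemma gen_act_boxed_left:
  assumes v: "v \<in> tensor_power V l" and "i < l" "l \<le> m"
  shows "gen_act U m i (v * tail l) = gen_act V l i v * tail l"
proof -
  have "lin_ext (basis_act i) (v * tail l) = lin_ext (basis_act i) v * tail l"
    using v
  proof (induction v rule: tensor_power_induct)
    case (monom g)
    then show ?case using assms(2) basis_act_append_left[of i g]
      by (simp add: monom_word_mult_tail) (simp add: tuples_def eta_top_power)
  qed (simp_all add: distrib_right scale_mult_left)
  then show ?thesis using mult_tail_closed[OF v assms(3)] v by (simp add: gen_act_eq_lin_ext)
qed

text \<open>For \<open>l < i\<close> both entries compared by generator \<open>i\<close> lie in the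
  tail and are equal, so the generator acts by the scalar.\<close>

lemma gen_act_boxed_right:
  assumes v: "v \<in> tensor_power V l" and "l < i" "i < m"
  shows "gen_act U m i (v * tail l) = inverse qq \<cdot> (v * tail l)"
proof -
  have "lin_ext (basis_act i) (v * tail l) = inverse qq \<cdot> (v * tail l)"
    using v
  proof (induction v rule: tensor_power_induct)
    case (monom g)
    then have "length g = l" by (simp add: tuples_def)
    moreover obtain j where "i = Suc j" using assms(2) less_imp_Suc_add by blast
    ultimately show ?case using assms(2,3) by (simp add: monom_word_mult_tail basis_act_def nth_append)
  qed (simp_all add: distrib_right scale_mult_left mult.commute)
  then show ?thesis using mult_tail_closed[OF v] assms by (simp add: gen_act_eq_lin_ext)
qed

text \<open>The generator sends M_f to a combination of M_f and the tensor of the swapped tuple,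
  neither of which is boxed.\<close>

lemma x_act_gen_act_not_boxed:
  assumes f: "f \<in> tuples U m" "\<not> boxed l f" and i: "0 < i" "i \<noteq> l" "i < m" and l: "l \<le> m" "\<sigma> permutes {1..l}"
  shows "x_act l \<sigma> (gen_act U m i (monom_word f)) = 0"
proof -
  have "lin_ext (\<lambda>f. if boxed l f then Psi V l (H_perm l \<sigma>) (monom_word (take l f)) * tail l else 0)
      (basis_act i f) = 0"
    using f not_boxed_tuple_s[OF f i l(1)] i(1) by (simp add: basis_act_def)
  then show ?thesis
    using f U.gen_act_closed[OF i(3), of "monom_word f"] by (simp add: x_act_def gen_act_eq_lin_ext)
qed

text \<open>The operator of level \<open>l\<close> takes values in the span of tensors boxed at
  \<open>l\<close>; none of these is boxed at \<open>k\<close>, so the operator of level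
  \<open>k\<close> kills them.\<close>

lemma x_act_x_act_orthogonal:
  assumes "l \<le> m" "\<sigma> permutes {1..l}" "k \<le> m" "\<gamma> permutes {1..k}" "l \<noteq> k" and v: "v \<in> tensor_power U m"
  shows "x_act k \<gamma> (x_act l \<sigma> v) = 0"
proof -
  note box = x_act_boxed[OF _ assms(1,2)] and X = x_act_End[OF assms(1,2)] and Y = x_act_End[OF assms(3,4)]
  note Y0 = End_algebra_zero[OF Y subspace_tensor_power]
  have kill: "x_act k \<gamma> (u * tail l) = 0" if u: "u \<in> tensor_power V l" for u
  proof -
    have "lin_ext (\<lambda>f. if boxed k f then Psi V k (H_perm k \<gamma>) (monom_word (take k f)) * tail k else 0) (u * tail l) = 0"
      using u
    proof (induction u rule: tensor_power_induct)
      case (monom g)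
      then have "boxed l (g @ replicate (m - l) top_index)" using boxed_iff[OF assms(1)] by blast
      then have "\<not> boxed k (g @ replicate (m - l) top_index)" using boxed_unique assms(1,3,5) by blast
      then show ?case by (simp add: monom_word_mult_tail)
    qed (simp_all add: distrib_right scale_mult_left)
    then show ?thesis using mult_tail_closed[OF u assms(1)] by (simp add: x_act_def)
  qed
  have "(\<lambda>v\<in>tensor_power U m. x_act k \<gamma> (x_act l \<sigma> v)) v = (\<lambda>v\<in>tensor_power U m. 0) v"
  proof (rule linear_eq_on_boxed[OF v assms(1)])
    show "(\<lambda>v\<in>tensor_power U m. x_act k \<gamma> (x_act l \<sigma> v)) \<in> carrier (End_algebra (tensor_power U m))"
      using End_algebraD[OF X] End_algebraD[OF Y] subspaceD(2,3)[OF subspace_tensor_power[of U m]]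
      by (auto simp: End_algebra_simps(1))
    show "(\<lambda>v\<in>tensor_power U m. 0) \<in> carrier (End_algebra (tensor_power U m))"
      by (rule zero_End_algebra[OF subspace_tensor_power])
  next
    fix u assume "u \<in> tensor_power V l"
    moreover from this have "Psi V l (H_perm l \<sigma>) u \<in> tensor_power V l"
      using End_algebraD(1)[OF tensor_module.perm_act_End[OF V_module assms(2)]] by blast
    ultimately show "(\<lambda>v\<in>tensor_power U m. x_act k \<gamma> (x_act l \<sigma> v)) (u * tail l) = (\<lambda>v\<in>tensor_power U m. 0) (u * tail l)"
      using kill mult_tail_closed[OF _ assms(1)] box by simp
  qed (simp add: x_act_not_boxed Y0)
  then show ?thesis using v by simp
qed

section \<open>The relations of the duplex algebra on tensor space\<close>

definition duplex_act :: "duplex_gen \<Rightarrow> (rat word \<Rightarrow>\<^sub>0 K) \<Rightarrow> (rat word \<Rightarrow>\<^sub>0 K)" where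
  "duplex_act g = (case g of
     T_gen i \<Rightarrow> act_on U m i
   | x_gen l \<sigma> \<Rightarrow> if l \<le> m \<and> \<sigma> permutes {1..l} then x_act l \<sigma> else (\<lambda>v\<in>tensor_power U m. 0))"

lemma duplex_act_End: "duplex_act g \<in> carrier (End_algebra (tensor_power U m))"
  using U.act_on_End x_act_End zero_End_algebra[OF subspace_tensor_power]
  by (simp add: duplex_act_def split: duplex_gen.split)

lemma eval_duplex_act_vanishI:
  assumes "l \<le> m" and v: "v \<in> tensor_power U m"
    and boxed: "\<And>u. u \<in> tensor_power V l \<Longrightarrow> eval_word_alg duplex_act p (u * tail l) = 0"
    and unboxed: "\<And>f. f \<in> tuples U m \<Longrightarrow> \<not> boxed l f \<Longrightarrow> eval_word_alg duplex_act p (monom_word f) = 0"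
  shows "eval_word_alg duplex_act p v = 0"
proof -
  note E = eval_End_algebra[where \<phi> = duplex_act, OF subspace_tensor_power duplex_act_End]
  have "(\<lambda>v\<in>tensor_power U m. eval_word_alg duplex_act p v) v = (\<lambda>v\<in>tensor_power U m. 0) v"
  proof (rule linear_eq_on_boxed[OF v assms(1)])
    show "(\<lambda>v\<in>tensor_power U m. eval_word_alg duplex_act p v) \<in> carrier (End_algebra (tensor_power U m))"
      using E subspaceD(2,3)[OF subspace_tensor_power[of U m]] by (auto simp: End_algebra_simps(1))
    show "(\<lambda>v\<in>tensor_power U m. 0) \<in> carrier (End_algebra (tensor_power U m))"
      by (rule zero_End_algebra[OF subspace_tensor_power])
  qed (use boxed unboxed mult_tail_closed[OF _ assms(1)] in auto)
  then show ?thesis using v by simp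
qed

text \<open>Evaluation reverses products: the left factor acts first. Apart from the Hecke relators
  and the orthogonality, each family is checked on boxed tensors, where it becomes a rule for the
  Hecke action on one of the two blocks, and on unboxed ones, where every term vanishes.\<close>

lemma duplex_relators_vanish:
  assumes p: "p \<in> duplex_relators m" and v: "v \<in> tensor_power U m"
  shows "eval_word_alg duplex_act p v = 0"
proof -
  let ?ev = "eval_word_alg duplex_act"
  let ?T = "\<lambda>i. var (T_gen i)" and ?x = "\<lambda>l \<sigma>. var (x_gen l \<sigma>)"
  let ?P = "\<lambda>l \<sigma>. Psi V l (H_perm l \<sigma>)"
  note M = eval_mult[where \<phi> = duplex_act, OF subspace_tensor_power duplex_act_End]
  have ev_T: "?ev (?T i) u = gen_act U m i u" if "i < m" for i u
    using that by (simp add: duplex_act_def act_on_def)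
  have ev_x: "?ev (?x l \<sigma>) u = x_act l \<sigma> u" if "l \<le> m" "\<sigma> permutes {1..l}" for l \<sigma> u
    using that by (simp add: duplex_act_def)
  have basis: "monom_word f \<in> tensor_power U m" if "f \<in> tuples U m" for f using that by simp
  have sp: "simple_refl i permutes {1..l}" if "0 < i" "i < l" for i l
    by (rule simple_refl_permutes) (use that in simp)
  have P: "?P l \<sigma> u \<in> tensor_power V l" if "\<sigma> permutes {1..l}" "u \<in> tensor_power V l" for l \<sigma> u
    using End_algebraD(1)[OF tensor_module.perm_act_End[OF V_module that(1)] that(2)] .
  have g: "gen_act V l i u \<in> tensor_power V l" if "i < l" "u \<in> tensor_power V l" for l i u
    by (rule tensor_module.gen_act_closed[OF V_module that])
  have P_s: "?P l (simple_refl i) u = gen_act V l i u" if "0 < i" "i < l" "u \<in> tensor_power V l" for l i u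
    by (rule tensor_module.perm_act_simple_refl[OF V_module]) (use that in simp_all)
  have x_0: "x_act l \<sigma> 0 = 0" if "l \<le> m" "\<sigma> permutes {1..l}" for l \<sigma>
    by (rule End_algebra_zero[OF x_act_End[OF that] subspace_tensor_power])
  have g_0: "gen_act U m i 0 = 0" if "i < m" for i
    by (rule End_algebra_zero[OF gen_act_End[OF II_neg_closed that] subspace_tensor_power])
  have xx: "?ev (?x l \<sigma> * ?x l \<gamma>) (u * tail l) = ?P l \<gamma> (?P l \<sigma> u) * tail l"
    if "l \<le> m" "\<sigma> permutes {1..l}" "\<gamma> permutes {1..l}" "u \<in> tensor_power V l" for l \<sigma> \<gamma> u
    unfolding M[OF mult_tail_closed[OF that(4,1)]] ev_x[OF that(1,2)] ev_x[OF that(1,3)]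
      x_act_boxed[OF that(4,1,2)] x_act_boxed[OF P[OF that(2,4)] that(1,3)] ..
  have xx_0: "?ev (?x l \<sigma> * ?x l \<gamma>) (monom_word f) = 0"
    if "l \<le> m" "\<sigma> permutes {1..l}" "\<gamma> permutes {1..l}" "f \<in> tuples U m" "\<not> boxed l f" for l \<sigma> \<gamma> f
    unfolding M[OF basis[OF that(4)]] ev_x[OF that(1,2)] ev_x[OF that(1,3)]
      x_act_not_boxed[OF that(4,5)] x_0[OF that(1,3)] ..
  have x: "?ev (?x l \<sigma>) (u * tail l) = ?P l \<sigma> u * tail l"
    if "l \<le> m" "\<sigma> permutes {1..l}" "u \<in> tensor_power V l" for l \<sigma> u
    unfolding ev_x[OF that(1,2)] x_act_boxed[OF that(3,1,2)] ..
  have x_not_boxed: "?ev (?x l \<sigma>) (monom_word f) = 0"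
    if "l \<le> m" "\<sigma> permutes {1..l}" "f \<in> tuples U m" "\<not> boxed l f" for l \<sigma> f
    unfolding ev_x[OF that(1,2)] x_act_not_boxed[OF that(3,4)] ..
  have Tx: "?ev (?T i * ?x l \<sigma>) (u * tail l) = ?P l \<sigma> (gen_act V l i u) * tail l"
    if "l \<le> m" "\<sigma> permutes {1..l}" "u \<in> tensor_power V l" "i < l" for l \<sigma> u i
    using that M[OF mult_tail_closed[OF that(3,1)]] ev_T[of i] ev_x[OF that(1,2)] gen_act_boxed_left[OF that(3,4,1)]
      x_act_boxed[OF g[OF that(4,3)] that(1,2)] by simp
  have xT: "?ev (?x l \<sigma> * ?T i) (u * tail l) = gen_act V l i (?P l \<sigma> u) * tail l"
    if "l \<le> m" "\<sigma> permutes {1..l}" "u \<in> tensor_power V l" "i < l" for l \<sigma> u i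
    using that M[OF mult_tail_closed[OF that(3,1)]] ev_T[of i] x[OF that(1-3)]
      gen_act_boxed_left[OF P[OF that(2,3)] that(4,1)] by simp
  have Tx_right: "?ev (?T i * ?x l \<sigma>) (u * tail l) = inverse qq \<cdot> (?P l \<sigma> u * tail l)"
    if "l \<le> m" "\<sigma> permutes {1..l}" "u \<in> tensor_power V l" "l < i" "i < m" for l \<sigma> u i
    using that M[OF mult_tail_closed[OF that(3,1)]] ev_T[of i] ev_x[OF that(1,2)] gen_act_boxed_right[OF that(3-5)]
      End_algebraD(3)[OF x_act_End[OF that(1,2)] mult_tail_closed[OF that(3,1)]]
      x_act_boxed[OF that(3,1,2)] by simp
  have xT_right: "?ev (?x l \<sigma> * ?T i) (u * tail l) = inverse qq \<cdot> (?P l \<sigma> u * tail l)"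
    if "l \<le> m" "\<sigma> permutes {1..l}" "u \<in> tensor_power V l" "l < i" "i < m" for l \<sigma> u i
    using that M[OF mult_tail_closed[OF that(3,1)]] ev_T[of i] x[OF that(1-3)]
      gen_act_boxed_right[OF P[OF that(2,3)] that(4,5)] by simp
  \<comment> \<open>Here the generator acts first and must not carry M_f into the boxed span, hence
    \<open>0 < i\<close> and \<open>i \<noteq> l\<close>; in the opposite product below, the
    \<open>x\<close> factor has already produced zero.\<close>
  have Tx_0: "?ev (?T i * ?x l \<sigma>) (monom_word f) = 0"
    if "l \<le> m" "\<sigma> permutes {1..l}" "f \<in> tuples U m" "\<not> boxed l f" "0 < i" "i \<noteq> l" "i < m" for l \<sigma> f i
    unfolding M[OF basis[OF that(3)]] ev_T[OF that(7)] ev_x[OF that(1,2)]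
      x_act_gen_act_not_boxed[OF that(3-7) that(1,2)] ..
  have xT_0: "?ev (?x l \<sigma> * ?T i) (monom_word f) = 0"
    if "l \<le> m" "\<sigma> permutes {1..l}" "f \<in> tuples U m" "\<not> boxed l f" "i < m" for l \<sigma> f i
    unfolding M[OF basis[OF that(3)]] x_not_boxed[OF that(1-4)] ev_T[OF that(5)] g_0[OF that(5)] ..
  have comp: "\<sigma> \<circ> simple_refl i permutes {1..l}" "simple_refl i \<circ> \<sigma> permutes {1..l}"
    if "\<sigma> permutes {1..l}" "0 < i" "i < l" for l \<sigma> i
    using that sp by (blast intro: permutes_compose)+
  consider (hecke) "p \<in> hecke_relators m ?T"
    | (right_ascent) l \<sigma> i where "l \<le> m" "\<sigma> permutes {1..l}" "0 < i" "i < l"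
        "len l (\<sigma> \<circ> simple_refl i) = len l \<sigma> + 1"
        "p = ?x l \<sigma> * ?x l (simple_refl i) - ?x l (\<sigma> \<circ> simple_refl i)"
    | (right_descent) l \<sigma> i where "l \<le> m" "\<sigma> permutes {1..l}" "0 < i" "i < l"
        "len l (\<sigma> \<circ> simple_refl i) + 1 = len l \<sigma>"
        "p = ?x l \<sigma> * ?x l (simple_refl i) - (?x l (\<sigma> \<circ> simple_refl i) + (inverse qq - qq) \<cdot> ?x l \<sigma>)"
    | (left_ascent) l \<sigma> i where "l \<le> m" "\<sigma> permutes {1..l}" "0 < i" "i < l"
        "len l (simple_refl i \<circ> \<sigma>) = len l \<sigma> + 1"
        "p = ?x l (simple_refl i) * ?x l \<sigma> - ?x l (simple_refl i \<circ> \<sigma>)"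
    | (left_descent) l \<sigma> i where "l \<le> m" "\<sigma> permutes {1..l}" "0 < i" "i < l"
        "len l (simple_refl i \<circ> \<sigma>) + 1 = len l \<sigma>"
        "p = ?x l (simple_refl i) * ?x l \<sigma> - (?x l (simple_refl i \<circ> \<sigma>) + (inverse qq - qq) \<cdot> ?x l \<sigma>)"
    | (orthogonal) l \<sigma> k \<gamma> where "l \<le> m" "k \<le> m" "l \<noteq> k" "\<sigma> permutes {1..l}" "\<gamma> permutes {1..k}"
        "p = ?x l \<sigma> * ?x k \<gamma>"
    | (Tx_inner) l \<sigma> i where "l \<le> m" "\<sigma> permutes {1..l}" "0 < i" "i < l"
        "p = ?T i * ?x l \<sigma> - ?x l (simple_refl i) * ?x l \<sigma>"
    | (xT_inner) l \<sigma> i where "l \<le> m" "\<sigma> permutes {1..l}" "0 < i" "i < l"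
        "p = ?x l \<sigma> * ?T i - ?x l \<sigma> * ?x l (simple_refl i)"
    | (Tx_outer) l \<sigma> i where "l \<le> m" "\<sigma> permutes {1..l}" "l < i" "i < m"
        "p = ?T i * ?x l \<sigma> - inverse qq \<cdot> ?x l \<sigma>"
    | (xT_outer) l \<sigma> i where "l \<le> m" "\<sigma> permutes {1..l}" "l < i" "i < m"
        "p = ?x l \<sigma> * ?T i - inverse qq \<cdot> ?x l \<sigma>"
    using p unfolding duplex_relators_def Let_def
  proof (elim UnE, goal_cases)
    case 1
    show ?thesis using 1(1,11) by blast
  next
    case 2
    show ?thesis using 2(2,11) by blast
  next
    case 3
    show ?thesis using 3(3,11) by blast
  next
    case 4
    show ?thesis using 4(4,11) by blast
  next
    case 5
    show ?thesis using 5(5,11) by blast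
  next
    case 6
    show ?thesis using 6(6,11) by blast
  next
    case 7
    show ?thesis using 7(7,11) by blast
  next
    case 8
    show ?thesis using 8(8,11) by blast
  next
    case 9
    show ?thesis using 9(9,11) by blast
  next
    case 10
    show ?thesis using 10(10,11) by blast
  qed
  then show ?thesis
  proof cases
    case hecke
    show ?thesis
      by (rule U.hecke_relators_vanish[OF duplex_act_End _ hecke v]) (simp add: duplex_act_def act_on_def)
  next
    case (right_ascent l \<sigma> i)
    note h = right_ascent(1-4) and c = comp[OF right_ascent(2-4)] and s = sp[OF right_ascent(3,4)]
    have i: "i \<in> {1..<l}" using h by simp
    show ?thesis unfolding right_ascent(6)
      by (rule eval_duplex_act_vanishI[OF h(1) v])
        (simp_all only: eval_diff eval_simps(1,2) xx[OF h(1,2) s] x[OF h(1) c(1)] P_s[OF h(3,4) P[OF h(2)]]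
          tensor_module.perm_act_right_ascent[OF V_module h(2) i right_ascent(5)]
          xx_0[OF h(1,2) s] x_not_boxed[OF h(1) c(1)] diff_self not_False_eq_True)
  next
    case (right_descent l \<sigma> i)
    note h = right_descent(1-4) and c = comp[OF right_descent(2-4)] and s = sp[OF right_descent(3,4)]
    have i: "i \<in> {1..<l}" using h by simp
    show ?thesis unfolding right_descent(6) qdiff_def[symmetric]
      by (rule eval_duplex_act_vanishI[OF h(1) v])
        (simp_all only: eval_diff eval_simps(1,2) xx[OF h(1,2) s] x[OF h(1) c(1)] x[OF h(1,2)] P_s[OF h(3,4) P[OF h(2)]]
          tensor_module.perm_act_right_descent[OF V_module h(2) i right_descent(5)]
          xx_0[OF h(1,2) s] x_not_boxed[OF h(1) c(1)] x_not_boxed[OF h(1,2)] diff_self not_False_eq_True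
          distrib_right scale_mult_left scale_simps(4) add_0_left)
  next
    case (left_ascent l \<sigma> i)
    note h = left_ascent(1-4) and c = comp[OF left_ascent(2-4)] and s = sp[OF left_ascent(3,4)]
    have i: "i \<in> {1..<l}" using h by simp
    show ?thesis unfolding left_ascent(6)
      by (rule eval_duplex_act_vanishI[OF h(1) v])
        (simp_all only: eval_diff eval_simps(1,2) xx[OF h(1) s h(2)] x[OF h(1) c(2)] P_s[OF h(3,4)]
          tensor_module.perm_act_left_ascent[OF V_module h(2) i left_ascent(5)]
          xx_0[OF h(1) s h(2)] x_not_boxed[OF h(1) c(2)] diff_self not_False_eq_True)
  next
    case (left_descent l \<sigma> i)
    note h = left_descent(1-4) and c = comp[OF left_descent(2-4)] and s = sp[OF left_descent(3,4)]
    have i: "i \<in> {1..<l}" using h by simp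
    show ?thesis unfolding left_descent(6) qdiff_def[symmetric]
      by (rule eval_duplex_act_vanishI[OF h(1) v])
        (simp_all only: eval_diff eval_simps(1,2) xx[OF h(1) s h(2)] x[OF h(1) c(2)] x[OF h(1,2)] P_s[OF h(3,4)]
          tensor_module.perm_act_left_descent[OF V_module h(2) i left_descent(5)]
          xx_0[OF h(1) s h(2)] x_not_boxed[OF h(1) c(2)] x_not_boxed[OF h(1,2)] diff_self not_False_eq_True
          distrib_right scale_mult_left scale_simps(4) add_0_left)
  next
    case (orthogonal l \<sigma> k \<gamma>)
    then show ?thesis
      using x_act_x_act_orthogonal[of l \<sigma> k \<gamma> v] v M[OF v, of "?x l \<sigma>" "?x k \<gamma>"]
        ev_x[of l \<sigma> v] ev_x[of k \<gamma>] by simp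
  next
    case (Tx_inner l \<sigma> i)
    note h = Tx_inner(1-4) and s = sp[OF Tx_inner(3,4)]
    have i: "i \<noteq> l" "i < m" using h by auto
    show ?thesis unfolding Tx_inner(5)
      by (rule eval_duplex_act_vanishI[OF h(1) v])
        (simp_all only: eval_diff Tx[OF h(1,2) _ h(4)] xx[OF h(1) s h(2)] P_s[OF h(3,4)]
          Tx_0[OF h(1,2) _ _ h(3) i] xx_0[OF h(1) s h(2)] diff_self not_False_eq_True)
  next
    case (xT_inner l \<sigma> i)
    note h = xT_inner(1-4) and s = sp[OF xT_inner(3,4)]
    have i: "i < m" using h by auto
    show ?thesis unfolding xT_inner(5)
      by (rule eval_duplex_act_vanishI[OF h(1) v])
        (simp_all only: eval_diff xT[OF h(1,2) _ h(4)] xx[OF h(1,2) s] P_s[OF h(3,4) P[OF h(2)]]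
          xT_0[OF h(1,2) _ _ i] xx_0[OF h(1,2) s] diff_self not_False_eq_True)
  next
    case (Tx_outer l \<sigma> i)
    note h = Tx_outer(1-4)
    have i: "0 < i" "i \<noteq> l" using h by auto
    show ?thesis unfolding Tx_outer(5)
      by (rule eval_duplex_act_vanishI[OF h(1) v])
        (simp_all only: eval_diff eval_simps(2) Tx_right[OF h(1,2) _ h(3,4)] x[OF h(1,2)]
          Tx_0[OF h(1,2) _ _ i h(4)] x_not_boxed[OF h(1,2)] scale_simps(4) diff_self not_False_eq_True)
  next
    case (xT_outer l \<sigma> i)
    note h = xT_outer(1-4)
    show ?thesis unfolding xT_outer(5)
      by (rule eval_duplex_act_vanishI[OF h(1) v])
        (simp_all only: eval_diff eval_simps(2) xT_right[OF h(1,2) _ h(3,4)] x[OF h(1,2)]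
          xT_0[OF h(1,2) _ _ h(4)] x_not_boxed[OF h(1,2)] scale_simps(4) diff_self not_False_eq_True)
  qed
qed

section \<open>Existence and uniqueness of the anti-homomorphism\<close>

lemma T_elem_eq: "T_elem m i = duplex.proj (var (T_gen i))"
  by (simp add: T_elem_def duplex.proj_simps(1))

lemma x_elem_eq: "x_elem m l \<sigma> = duplex.proj (var (x_gen l \<sigma>))"
  by (simp add: x_elem_def duplex.proj_simps(1))

lemma duplex_antihom_exists:
  obtains \<Xi> where "\<Xi> \<in> alg_antihom (duplex m) (End_algebra (tensor_power U m))"
    "\<And>i. i < m \<Longrightarrow> \<Xi> (T_elem m i) = gen_act U m i"
    "\<And>l \<sigma>. l \<le> m \<Longrightarrow> \<sigma> permutes {1..l} \<Longrightarrow> \<Xi> (x_elem m l \<sigma>) = x_act l \<sigma>"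
proof -
  obtain \<Xi> where \<Xi>: "\<Xi> \<in> alg_antihom (duplex m) (End_algebra (tensor_power U m))"
    "\<And>p. p \<in> carrier (free_algebra (duplex_gens m)) \<Longrightarrow>
      \<Xi> (duplex.proj p) = (\<lambda>v\<in>tensor_power U m. eval_word_alg duplex_act p v)"
    using duplex.alg_antihom_exists[where \<phi> = duplex_act,
        OF subspace_tensor_power duplex_act_End duplex_relators_vanish]
    unfolding duplex_def by blast
  have gen: "\<Xi> (duplex.proj (var g)) = restrict (duplex_act g) (tensor_power U m)" if "g \<in> duplex_gens m" for g
    using \<Xi>(2)[of "var g"] that by (simp add: free_algebra_closed(7))
  show ?thesis
  proof (rule that[OF \<Xi>(1)])
    fix i assume "i < m"
    then show "\<Xi> (T_elem m i) = gen_act U m i"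
      using gen[of "T_gen i"]
      by (simp add: T_elem_eq duplex_gens_def duplex_act_def act_on_def restrict_gen_act)
  next
    fix l \<sigma> assume "l \<le> m" "\<sigma> permutes {1..l}"
    then have "\<Xi> (x_elem m l \<sigma>) = restrict (x_act l \<sigma>) (tensor_power U m)"
      using gen[of "x_gen l \<sigma>"] by (simp add: x_elem_eq duplex_gens_def duplex_act_def)
    then show "\<Xi> (x_elem m l \<sigma>) = x_act l \<sigma>" by (simp add: x_act_def restrict_restrict)
  qed
qed

end

theorem proposition2p4:
  fixes r m :: nat
  assumes "r \<ge> 1" and "m \<ge> 2"
  shows "\<exists>!\<Xi>. \<Xi> \<in> alg_antihom (duplex m) (End_algebra (tensor_power (II (2 * r + 4)) m)) \<and>
    (\<forall>i<m. \<Xi> (T_elem m i) = Psi (II (2 * r + 4)) m (H_gen m i)) \<and>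
    (\<forall>l\<le>m. \<forall>\<sigma>. \<sigma> permutes {1..l} \<longrightarrow>
      (\<forall>v\<in>tensor_power (II (2 * r + 2)) l.
         \<Xi> (x_elem m l \<sigma>) (v * eta_top r ^ (m - l)) =
         Psi (II (2 * r + 2)) l (H_perm l \<sigma>) v * eta_top r ^ (m - l))) \<and>
    (\<forall>l\<le>m. \<forall>\<sigma>. \<sigma> permutes {1..l} \<longrightarrow>
      (\<forall>f\<in>tuples (II (2 * r + 4)) m. monom_word f \<notin> V_sub r m l \<longrightarrow>
         \<Xi> (x_elem m l \<sigma>) (monom_word f) = 0))"
proof -
  interpret duplex_action r m .
  let ?W = "tensor_power (II (2 * r + 4)) m"
  obtain \<Xi> where \<Xi>: "\<Xi> \<in> alg_antihom (duplex m) (End_algebra ?W)"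
    "\<And>i. i < m \<Longrightarrow> \<Xi> (T_elem m i) = gen_act (II (2 * r + 4)) m i"
    "\<And>l \<sigma>. l \<le> m \<Longrightarrow> \<sigma> permutes {1..l} \<Longrightarrow> \<Xi> (x_elem m l \<sigma>) = x_act l \<sigma>"
    using duplex_antihom_exists by blast
  show ?thesis
  proof (rule ex1I[of _ \<Xi>])
    show "\<Xi> \<in> alg_antihom (duplex m) (End_algebra ?W) \<and>
      (\<forall>i<m. \<Xi> (T_elem m i) = Psi (II (2 * r + 4)) m (H_gen m i)) \<and>
      (\<forall>l\<le>m. \<forall>\<sigma>. \<sigma> permutes {1..l} \<longrightarrow> (\<forall>v\<in>tensor_power (II (2 * r + 2)) l.
         \<Xi> (x_elem m l \<sigma>) (v * eta_top r ^ (m - l)) =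
         Psi (II (2 * r + 2)) l (H_perm l \<sigma>) v * eta_top r ^ (m - l))) \<and>
      (\<forall>l\<le>m. \<forall>\<sigma>. \<sigma> permutes {1..l} \<longrightarrow> (\<forall>f\<in>tuples (II (2 * r + 4)) m. monom_word f \<notin> V_sub r m l \<longrightarrow>
         \<Xi> (x_elem m l \<sigma>) (monom_word f) = 0))"
    proof (intro conjI allI impI ballI)
      fix l \<sigma> v assume "l \<le> m" "\<sigma> permutes {1..l}" "v \<in> tensor_power (II (2 * r + 2)) l"
      then show "\<Xi> (x_elem m l \<sigma>) (v * eta_top r ^ (m - l)) =
          Psi (II (2 * r + 2)) l (H_perm l \<sigma>) v * eta_top r ^ (m - l)"
        by (simp only: \<Xi>(3) x_act_boxed)
    next
      fix l \<sigma> f assume "l \<le> m" "\<sigma> permutes {1..l}" "f \<in> tuples (II (2 * r + 4)) m" "monom_word f \<notin> V_sub r m l"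
      then show "\<Xi> (x_elem m l \<sigma>) (monom_word f) = 0"
        by (simp only: \<Xi>(3) monom_word_in_V_sub_iff x_act_not_boxed not_False_eq_True)
    qed (simp_all only: \<Xi>(1,2) U.Psi_H_gen)
  next
    fix \<Theta> assume \<Theta>: "\<Theta> \<in> alg_antihom (duplex m) (End_algebra ?W) \<and>
      (\<forall>i<m. \<Theta> (T_elem m i) = Psi (II (2 * r + 4)) m (H_gen m i)) \<and>
      (\<forall>l\<le>m. \<forall>\<sigma>. \<sigma> permutes {1..l} \<longrightarrow> (\<forall>v\<in>tensor_power (II (2 * r + 2)) l.
         \<Theta> (x_elem m l \<sigma>) (v * eta_top r ^ (m - l)) =
         Psi (II (2 * r + 2)) l (H_perm l \<sigma>) v * eta_top r ^ (m - l))) \<and>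
      (\<forall>l\<le>m. \<forall>\<sigma>. \<sigma> permutes {1..l} \<longrightarrow> (\<forall>f\<in>tuples (II (2 * r + 4)) m. monom_word f \<notin> V_sub r m l \<longrightarrow>
         \<Theta> (x_elem m l \<sigma>) (monom_word f) = 0))"
    note \<Theta>_antihom = \<Theta>[THEN conjunct1]
      and \<Theta>_T = \<Theta>[THEN conjunct2, THEN conjunct1, rule_format]
      and \<Theta>_boxed = \<Theta>[THEN conjunct2, THEN conjunct2, THEN conjunct1, rule_format]
      and \<Theta>_not_boxed = \<Theta>[THEN conjunct2, THEN conjunct2, THEN conjunct2, rule_format]
    have x: "\<Theta> (x_elem m l \<sigma>) = \<Xi> (x_elem m l \<sigma>)" if l: "l \<le> m" "\<sigma> permutes {1..l}" for l \<sigma>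
    proof (rule extensionalityI[of _ ?W])
      have "var (x_gen l \<sigma>) \<in> carrier (free_algebra (duplex_gens m))"
        using l by (simp add: free_algebra_closed(7) duplex_gens_def)
      then have "x_elem m l \<sigma> \<in> carrier (duplex m)"
        unfolding x_elem_eq duplex_def duplex.proj_simps(3) by (rule imageI)
      moreover have "\<Theta> \<in> carrier (duplex m) \<rightarrow>\<^sub>E carrier (End_algebra ?W)"
        using \<Theta>_antihom unfolding alg_antihom_def by blast
      \<comment> \<open>The prescribed values concern only two kinds of tensors; membership in the
        endomorphism algebra supplies the linearity that extends the agreement to all of
        \<open>?W\<close>.\<close>
      ultimately have End: "\<Theta> (x_elem m l \<sigma>) \<in> carrier (End_algebra ?W)" by (rule PiE_mem[rotated])
      then show "\<Theta> (x_elem m l \<sigma>) \<in> extensional ?W" by (simp add: End_algebra_simps(1) PiE_def)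
      show "\<Xi> (x_elem m l \<sigma>) \<in> extensional ?W" using \<Xi>(3)[OF l] by (simp add: x_act_def)
      fix v assume v: "v \<in> ?W"
      show "\<Theta> (x_elem m l \<sigma>) v = \<Xi> (x_elem m l \<sigma>) v"
        unfolding \<Xi>(3)[OF l]
      proof (rule linear_eq_on_boxed[OF v l(1) End x_act_End[OF l]])
        fix v assume "v \<in> tensor_power (II (2 * r + 2)) l"
        then show "\<Theta> (x_elem m l \<sigma>) (v * tail l) = x_act l \<sigma> (v * tail l)"
          using \<Theta>_boxed[OF l] x_act_boxed[OF _ l] by (simp only:)
      next
        fix f assume f: "f \<in> tuples (II (2 * r + 4)) m" "\<not> boxed l f"
        then have "monom_word f \<notin> V_sub r m l" using monom_word_in_V_sub_iff[OF l(1)] by blast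
        then show "\<Theta> (x_elem m l \<sigma>) (monom_word f) = x_act l \<sigma> (monom_word f)"
          unfolding x_act_not_boxed[OF f] by (rule \<Theta>_not_boxed[OF l f(1)])
      qed
    qed
    have T: "\<Theta> (T_elem m i) = \<Xi> (T_elem m i)" if "i < m" for i
      unfolding \<Theta>_T[OF that] \<Xi>(2)[OF that] by (rule U.Psi_H_gen[OF that])
    show "\<Theta> = \<Xi>"
    proof (rule duplex.alg_antihom_ext)
      fix g assume "g \<in> duplex_gens m"
      then consider i where "g = T_gen i" "i < m" | l \<sigma> where "g = x_gen l \<sigma>" "l \<le> m" "\<sigma> permutes {1..l}"
        unfolding duplex_gens_def by blast
      then show "\<Theta> (presented_gen (duplex_gens m) (duplex_relators m) g) =
          \<Xi> (presented_gen (duplex_gens m) (duplex_relators m) g)"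
        by cases (use T x in \<open>simp_all only: T_elem_def x_elem_def\<close>)
    qed (use \<Theta>_antihom \<Xi>(1) in \<open>simp_all add: duplex_def\<close>)
  qed
qed

end
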